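(* Let $\{\ln(\sigma_t^2)\}_{t\in\mathbb Z}$ be the stochastic process defined by $\ln(\sigma_t^2)=\omega+\frac{\alpha(\mathcal B)}{\beta(\mathcal B)}(1-\mathcal B^s)^{-d}g(Z_{t-1})$, $t\in\mathbb Z$, with $d<0.5$. Then $\{\ln(\sigma_t^2)\}_{t\in\mathbb Z}$ is a causal SARFIMA$(q,0,p)\times(0,D,0)_s$ process, with $D=d$.
   Context: $\mathcal B$ is the backward shift operator. $\{Z_t\}_{t\in\mathbb Z}$ is i.i.d. with zero mean and variance one; $g(Z_t)=\theta Z_t+\gamma[|Z_t|-\mathbb E(|Z_t|)]$ with $\theta,\gamma\in\mathbb R$; $\omega,d\in\mathbb R$; $s\ge1$ is an integer; $\alpha(z)=\sum_{i=0}^p(-\alpha_i)z^i$ and $\beta(z)=\sum_{j=0}^q(-\beta_j)z^j$ are real polynomials of orders $p,q$ with $\alpha_0=\beta_0=-1$, without common roots, and $\beta(z)\neq0$ for $|z|\le1$. The operator $\frac{\alpha(\mathcal B)}{\beta(\mathcal B)}(1-\mathcal B^s)^{-d}$ means $\sum_{k\ge0}\lambda_{d,k}\mathcal B^k$, where $\frac{\alpha(z)}{\beta(z)}(1-z^s)^{-d}=\sum_{k=0}^\infty\lambda_{d,k}z^k$, $|z|<1$. A process $\{Y_t\}_{t\in\mathbb Z}$ is a SARFIMA$(m,0,n)\times(0,D,0)_s$ process if, for some $\mu\in\mathbb R$, some polynomials $a(\cdot)$ and $b(\cdot)$ of orders $m$ and $n$ (autoregressive and moving average, respectively) with constant term $1$,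 and some zero-mean white noise $\{\varepsilon_t\}_{t\in\mathbb Z}$, it satisfies $a(\mathcal B)(1-\mathcal B^s)^D(Y_t-\mu)=b(\mathcal B)\varepsilon_t$ for all $t\in\mathbb Z$. It is causal if $Y_t-\mu=\sum_{k\ge0}\psi_k\varepsilon_{t-k}$ with convergence in $L^2$, where $\sum_{k\ge 0}\psi_kz^k=\frac{b(z)}{a(z)}(1-z^s)^{-D}$ for $|z|<1$.
   Formalization: For d ≤ -1 the series for β(B)(1-B^s)^d(Y_t-μ) does not converge in mean square (d=-1, s=1, α=β=1: partial sums ε_t-ε_{t-n}); there the operator is the mean-square Abel limit r→1- of the operator at rB. For -1<d<1/2 it is the ordinary mean-square sum. *)

theory Defs
  imports "HOL-Probability.Probability" "HOL-Computational_Algebra.Polynomial"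
begin

section \<open>Mean-square convergence\<close>

definition square_integrable :: "'a measure \<Rightarrow> ('a \<Rightarrow> real) \<Rightarrow> bool" where
  "square_integrable M X \<longleftrightarrow> X \<in> borel_measurable M \<and> integrable M (\<lambda>x. (X x)\<^sup>2)"

(* The integrability conditions are needed because the Bochner integral of a
   non-integrable function is 0. *)
definition L2_tendsto ::
  "'a measure \<Rightarrow> ('i \<Rightarrow> 'a \<Rightarrow> real) \<Rightarrow> ('a \<Rightarrow> real) \<Rightarrow> 'i filter \<Rightarrow> bool" where
  "L2_tendsto M X V F \<longleftrightarrow>
     (\<forall>\<^sub>F i in F. square_integrable M (X i)) \<and> square_integrable M V \<and>
     ((\<lambda>i. \<integral>x. (X i x - V x)\<^sup>2 \<partial>M) \<longlongrightarrow> 0) F"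

definition L2_sums :: "'a measure \<Rightarrow> (nat \<Rightarrow> 'a \<Rightarrow> real) \<Rightarrow> ('a \<Rightarrow> real) \<Rightarrow> bool" where
  "L2_sums M X V \<longleftrightarrow> L2_tendsto M (\<lambda>n x. \<Sum>k<n. X k x) V sequentially"

section \<open>Power series in the backward shift\<close>

abbreviation cpoly :: "real poly \<Rightarrow> complex \<Rightarrow> complex" where
  "cpoly p z \<equiv> poly (map_poly of_real p) z"

definition disc_expansion :: "(complex \<Rightarrow> complex) \<Rightarrow> (nat \<Rightarrow> real) \<Rightarrow> bool" where
  "disc_expansion f c \<longleftrightarrow> (\<forall>z. norm z < 1 \<longrightarrow> (\<lambda>k. of_real (c k) * z ^ k) sums (f z))"

(* For norm z < 1 and s >= 1 the base 1 - z^s has positive real part, so the principal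
   branch used by powr is the usual binomial one, with value 1 at z = 0. *)
definition frac_diff :: "nat \<Rightarrow> real \<Rightarrow> complex \<Rightarrow> complex" where
  "frac_diff s D z = (1 - z ^ s) powr (of_real D)"

definition shift_series ::
  "'a measure \<Rightarrow> (nat \<Rightarrow> real) \<Rightarrow> (int \<Rightarrow> 'a \<Rightarrow> real) \<Rightarrow> int \<Rightarrow> ('a \<Rightarrow> real) \<Rightarrow> bool" where
  "shift_series M c X t V \<longleftrightarrow> L2_sums M (\<lambda>k x. c k * X (t - int k) x) V"

definition Abel_shift_series ::
  "'a measure \<Rightarrow> (nat \<Rightarrow> real) \<Rightarrow> (int \<Rightarrow> 'a \<Rightarrow> real) \<Rightarrow> int \<Rightarrow> ('a \<Rightarrow> real) \<Rightarrow> bool" where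
  "Abel_shift_series M c X t V \<longleftrightarrow>
     (\<exists>W :: real \<Rightarrow> 'a \<Rightarrow> real.
        (\<forall>r. 0 < r \<and> r < 1 \<longrightarrow> shift_series M (\<lambda>k. r ^ k * c k) X t (W r)) \<and>
        L2_tendsto M W V (at_left 1))"

section \<open>SARFIMA processes\<close>

(* Not required to be nondegenerate: the common variance v may be 0. *)
definition white_noise :: "'a measure \<Rightarrow> (int \<Rightarrow> 'a \<Rightarrow> real) \<Rightarrow> bool" where
  "white_noise M eps \<longleftrightarrow>
     (\<forall>t. square_integrable M (eps t)) \<and>
     (\<forall>t. (\<integral>x. eps t x \<partial>M) = 0) \<and>
     (\<exists>v. \<forall>t. (\<integral>x. (eps t x)\<^sup>2 \<partial>M) = v) \<and>
     (\<forall>t u. t \<noteq> u \<longrightarrow> (\<integral>x. eps t x * eps u x \<partial>M) = 0)"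

(* The equation a(B) (1 - B^s)^D (Y_t - mu) = b(B) eps_t for all t.
   For D > -1 the left-hand side is the mean-square sum of the series.  For D <= -1 that
   series has no sum in general, even when Y is a causal solution: with D = -1, s = 1,
   Y_t = eps_t - eps_(t-1), the partial sums eps_t - eps_(t-n) do not converge.  There
   the operator is understood as the mean-square limit, as r tends to 1 from below, of
   the operators given by the expansion evaluated at r B.  By Abel's theorem this agrees
   with the mean-square sum whenever the latter exists. *)
definition SARFIMA_equation ::
  "'a measure \<Rightarrow> real poly \<Rightarrow> real poly \<Rightarrow> real \<Rightarrow> nat \<Rightarrow> real \<Rightarrow>
   (int \<Rightarrow> 'a \<Rightarrow> real) \<Rightarrow> (int \<Rightarrow> 'a \<Rightarrow> real) \<Rightarrow> bool" where
  "SARFIMA_equation M a b D s mu eps Y \<longleftrightarrow>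
     (\<exists>c. disc_expansion (\<lambda>z. cpoly a z * frac_diff s D z) c \<and>
        (\<forall>t. (if D > -1 then shift_series else Abel_shift_series) M c
               (\<lambda>u x. Y u x - mu) t
               (\<lambda>x. \<Sum>j\<le>degree b. coeff b j * eps (t - int j) x)))"

definition SARFIMA_with ::
  "'a measure \<Rightarrow> nat \<Rightarrow> nat \<Rightarrow> real \<Rightarrow> nat \<Rightarrow> real \<Rightarrow> real poly \<Rightarrow> real poly \<Rightarrow>
   (int \<Rightarrow> 'a \<Rightarrow> real) \<Rightarrow> (int \<Rightarrow> 'a \<Rightarrow> real) \<Rightarrow> bool" where
  "SARFIMA_with M m n D s mu a b eps Y \<longleftrightarrow>
     (\<forall>t. Y t \<in> borel_measurable M) \<and>
     degree a = m \<and> coeff a 0 = 1 \<and> degree b = n \<and> coeff b 0 = 1 \<and>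
     white_noise M eps \<and> SARFIMA_equation M a b D s mu eps Y"

(* Y is a SARFIMA(m,0,n) x (0,D,0)_s process. *)
definition SARFIMA ::
  "'a measure \<Rightarrow> nat \<Rightarrow> nat \<Rightarrow> real \<Rightarrow> nat \<Rightarrow> (int \<Rightarrow> 'a \<Rightarrow> real) \<Rightarrow> bool" where
  "SARFIMA M m n D s Y \<longleftrightarrow> (\<exists>mu a b eps. SARFIMA_with M m n D s mu a b eps Y)"

definition causal_SARFIMA ::
  "'a measure \<Rightarrow> nat \<Rightarrow> nat \<Rightarrow> real \<Rightarrow> nat \<Rightarrow> (int \<Rightarrow> 'a \<Rightarrow> real) \<Rightarrow> bool" where
  "causal_SARFIMA M m n D s Y \<longleftrightarrow>
     (\<exists>mu a b eps. SARFIMA_with M m n D s mu a b eps Y \<and>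
        (\<exists>\<psi>. disc_expansion (\<lambda>z. cpoly b z / cpoly a z * frac_diff s (- D) z) \<psi> \<and>
             (\<forall>t. shift_series M \<psi> eps t (\<lambda>x. Y t x - mu))))"

section \<open>The noise and the news function\<close>

definition iid_standardized :: "'a measure \<Rightarrow> (int \<Rightarrow> 'a \<Rightarrow> real) \<Rightarrow> bool" where
  "iid_standardized M Z \<longleftrightarrow>
     prob_space.indep_vars M (\<lambda>_. borel) Z UNIV \<and>
     (\<forall>t u. distr M borel (Z t) = distr M borel (Z u)) \<and>
     (\<forall>t. integrable M (\<lambda>x. (Z t x)\<^sup>2) \<and> (\<integral>x. Z t x \<partial>M) = 0 \<and>
          (\<integral>x. (Z t x)\<^sup>2 \<partial>M) = 1)"

definition news :: "'a measure \<Rightarrow> real \<Rightarrow> real \<Rightarrow> ('a \<Rightarrow> real) \<Rightarrow> 'a \<Rightarrow> real" where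
  "news M \<theta> \<gamma> X x = \<theta> * X x + \<gamma> * (\<bar>X x\<bar> - (\<integral>y. \<bar>X y\<bar> \<partial>M))"

end

theory Submission
  imports Defs "HOL-Complex_Analysis.Complex_Analysis" "HOL-Real_Asymp.Real_Asymp"
begin

text \<open>
  With innovations \<open>\<epsilon>\<^sub>t = g(Z\<^sub>t\<^sub>-\<^sub>1)\<close>, mean \<open>\<omega>\<close>, autoregressive polynomial \<open>\<beta>\<close> and moving average
  polynomial \<open>\<alpha>\<close>, the defining series of the log-volatility is already its causal representation,
  and the \<open>\<epsilon>\<^sub>t\<close> are white noise because they are centred, identically distributed, pairwise
  independent and square integrable.  What has to be proved is the difference equation: applying
  \<open>c(\<B>) = \<beta>(\<B>)(1 - \<B>\<^sup>s)\<^sup>d\<close> to \<open>Y\<^sub>t = \<lambda>(\<B>)\<epsilon>\<^sub>t\<close> gives \<open>\<alpha>(\<B>)\<epsilon>\<^sub>t\<close>.  As formal power series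
  \<open>c \<lambda> = \<alpha>\<close>, so the only issue is convergence, and it is a real one: for \<open>d \<le> -1/2\<close> the
  coefficients \<open>c\<^sub>k\<close> are not even square summable, so the cancellation built into \<open>Y\<close> has to
  be used.

  A finite filter \<open>\<Sum>\<^sub>k\<^sub><\<^sub>n c\<^sub>k Y\<^sub>t\<^sub>-\<^sub>k\<close> is again a linear filter of the noise, with the coefficients of
  the product of the truncated series \<open>c\<close> with \<open>\<lambda>\<close>.  The isometry between coefficient
  sequences and random variables (\<open>isometry_energy\<close>) turns mean-square convergence into the
  convergence of these products to \<open>\<alpha>\<close> in \<open>\<ell>\<^sup>2\<close>.  There are three regimes.

  \<^item> \<open>0 \<le> d < 1/2\<close>.  Here \<open>c\<close> is absolutely summable and \<open>\<lambda>\<close> square summable, and Young's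
    inequality \<open>\<parallel>f g\<parallel>\<^sub>2 \<le> \<parallel>f\<parallel>\<^sub>1 \<parallel>g\<parallel>\<^sub>2\<close> suffices (\<open>truncated_mult_tendsto\<close>).

  \<^item> \<open>-1 < d < 0\<close>.  The series \<open>C = (1 - z\<^sup>s)\<^sup>d\<close> has nonnegative coefficients that tend to \<open>0\<close>, and its
    inverse \<open>l\<close> has nonpositive coefficients after the constant term, with sum \<open>\<ge> 0\<close>.  When the
    coefficients of \<open>C\<close> are multiplied by nonincreasing weights in \<open>[0,1]\<close>, all coefficients of the product
    with \<open>l\<close> except the first become nonpositive, which bounds their \<open>\<ell>\<^sup>1\<close> norm by \<open>2\<close> whatever
    the weights; they also become uniformly small as the weights tend to \<open>1\<close>.  Bounded in \<open>\<ell>\<^sup>1\<close> and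
    small in \<open>\<ell>\<^sup>\<infinity>\<close> means small in \<open>\<ell>\<^sup>2\<close> (\<open>weighted_product_tendsto\<close>).  Truncation is the choice of
    weights \<open>1\<close> below \<open>n\<close> and \<open>0\<close> from there on.

  \<^item> \<open>d \<le> -1\<close>.  The operator is an Abel limit, that is, the weights are \<open>r\<^sup>k\<close>.  These
    weights respect products, so \<open>(1 - z\<^sup>s)\<^sup>d\<close> can be written as a power of \<open>(1 - z\<^sup>s)\<^sup>-\<^sup>\<eta>\<close> with
    \<open>0 < \<eta> < 1\<close>, to which the same argument applies; the uniform \<open>\<ell>\<^sup>1\<close> bound carries the
    limit over to powers.

  The rational factor costs nothing more: \<open>\<beta>\<close> is a finite sum of lags, and \<open>\<alpha>/\<beta>\<close> is absolutely
  summable because \<open>\<beta>\<close> has no zeros in some disc of radius greater than \<open>1\<close>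
  (\<open>weighted_poly_product_tendsto\<close>).
\<close>

section \<open>Absolutely summable and square summable coefficient sequences\<close>

text \<open>
  Formal power series serve as coefficient sequences, so that composing two filters is
  multiplying two series.  Square summable ones are measured by their squared \<open>\<ell>\<^sup>2\<close> norm, the
  energy, since it is the variance of the filtered noise up to a factor.
\<close>

definition abs_summable :: "real fps \<Rightarrow> bool" where
  "abs_summable f \<longleftrightarrow> summable (\<lambda>k. \<bar>fps_nth f k\<bar>)"

definition l1_norm :: "real fps \<Rightarrow> real" where
  "l1_norm f = (\<Sum>k. \<bar>fps_nth f k\<bar>)"

definition sq_summable :: "real fps \<Rightarrow> bool" where
  "sq_summable f \<longleftrightarrow> summable (\<lambda>k. (fps_nth f k)\<^sup>2)"

definition energy :: "real fps \<Rightarrow> real" where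
  "energy f = (\<Sum>k. (fps_nth f k)\<^sup>2)"

lemma l1_norm_nonneg: "abs_summable f \<Longrightarrow> 0 \<le> l1_norm f"
  by (simp add: abs_summable_def l1_norm_def suminf_nonneg)

lemma energy_nonneg: "sq_summable f \<Longrightarrow> 0 \<le> energy f"
  by (simp add: sq_summable_def energy_def suminf_nonneg)

lemma abs_summable_finite_support:
  assumes "\<And>k. k \<ge> n \<Longrightarrow> fps_nth f k = 0"
  shows "abs_summable f"
  unfolding abs_summable_def
  by (rule summable_finite[of "{..<n}"]) (use assms in auto)

lemma sq_summable_finite_support:
  assumes "\<And>k. k \<ge> n \<Longrightarrow> fps_nth f k = 0"
  shows "sq_summable f"
  unfolding sq_summable_def
  by (rule summable_finite[of "{..<n}"]) (use assms in auto)

lemma abs_summable_1 [simp]: "abs_summable 1"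
  by (rule abs_summable_finite_support[of 1]) auto

lemma sq_summable_0 [simp]: "sq_summable 0" and energy_0 [simp]: "energy 0 = 0"
  by (auto simp: sq_summable_def energy_def)

lemma
  assumes "sq_summable f" "sq_summable g"
  shows sq_summable_add: "sq_summable (f + g)" and energy_add: "energy (f + g) \<le> 2 * energy f + 2 * energy g"
proof -
  have le: "(fps_nth (f + g) k)\<^sup>2 \<le> 2 * (fps_nth f k)\<^sup>2 + 2 * (fps_nth g k)\<^sup>2" for k
    using sum_squares_bound[of "fps_nth f k" "fps_nth g k"] by (simp add: power2_sum)
  have s: "summable (\<lambda>k. 2 * (fps_nth f k)\<^sup>2)" "summable (\<lambda>k. 2 * (fps_nth g k)\<^sup>2)"
    using assms by (auto simp: sq_summable_def)
  show *: "sq_summable (f + g)"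
    unfolding sq_summable_def
    by (rule summable_comparison_test'[OF summable_add[OF s], of 0]) (use le in auto)
  have "energy (f + g) \<le> (\<Sum>k. 2 * (fps_nth f k)\<^sup>2 + 2 * (fps_nth g k)\<^sup>2)"
    unfolding energy_def
    by (rule suminf_le[OF le]) (use * s in \<open>auto simp: sq_summable_def intro: summable_add\<close>)
  also have "\<dots> = 2 * energy f + 2 * energy g"
    using assms by (simp add: suminf_add[OF s, symmetric] energy_def suminf_mult sq_summable_def)
  finally show "energy (f + g) \<le> 2 * energy f + 2 * energy g" .
qed

lemma
  assumes "sq_summable f"
  shows sq_summable_cmult: "sq_summable (fps_const a * f)" and energy_cmult: "energy (fps_const a * f) = a\<^sup>2 * energy f"
  using assms by (auto simp: sq_summable_def energy_def power_mult_distrib suminf_mult)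

lemma abs_summable_mult:
  assumes "abs_summable f" "abs_summable g"
  shows "abs_summable (f * g)"
proof -
  let ?C = "\<lambda>m. \<Sum>i\<le>m. \<bar>fps_nth f i\<bar> * \<bar>fps_nth g (m - i)\<bar>"
  have C: "?C sums (l1_norm f * l1_norm g)"
    unfolding l1_norm_def
    by (rule Cauchy_product_sums) (use assms in \<open>auto simp: abs_summable_def\<close>)
  have le: "\<bar>fps_nth (f * g) m\<bar> \<le> ?C m" for m
    unfolding fps_mult_nth atLeast0AtMost abs_mult[symmetric] by (rule sum_abs)
  show ?thesis
    unfolding abs_summable_def
    by (rule summable_comparison_test'[OF sums_summable[OF C], of 0]) (use le in auto)
qed

lemma
  assumes "abs_summable f" "sq_summable g"
  shows sq_summable_mult: "sq_summable (f * g)"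
    and energy_mult_le: "energy (f * g) \<le> (l1_norm f)\<^sup>2 * energy g"
proof -
  let ?C = "\<lambda>m. \<Sum>i\<le>m. \<bar>fps_nth f i\<bar> * (fps_nth g (m - i))\<^sup>2"
  have C: "?C sums (l1_norm f * energy g)"
    unfolding l1_norm_def energy_def
    by (rule Cauchy_product_sums) (use assms in \<open>auto simp: abs_summable_def sq_summable_def\<close>)
  have le: "(fps_nth (f * g) m)\<^sup>2 \<le> l1_norm f * ?C m" for m
  proof -
    have "\<bar>fps_nth (f * g) m\<bar> \<le> (\<Sum>i\<le>m. \<bar>fps_nth f i\<bar> * \<bar>fps_nth g (m - i)\<bar>)"
      unfolding fps_mult_nth atLeast0AtMost abs_mult[symmetric] by (rule sum_abs)
    also have "\<dots> = (\<Sum>i\<le>m. sqrt \<bar>fps_nth f i\<bar> * (sqrt \<bar>fps_nth f i\<bar> * \<bar>fps_nth g (m - i)\<bar>))"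
      by (simp add: mult.assoc[symmetric])
    finally have "(fps_nth (f * g) m)\<^sup>2 \<le> 
        (\<Sum>i\<le>m. sqrt \<bar>fps_nth f i\<bar> * (sqrt \<bar>fps_nth f i\<bar> * \<bar>fps_nth g (m - i)\<bar>))\<^sup>2"
      by (rule power2_le_iff_abs_le[THEN iffD2, rotated]) (auto intro!: sum_nonneg)
    also have "\<dots> \<le> (\<Sum>i\<le>m. (sqrt \<bar>fps_nth f i\<bar>)\<^sup>2) * 
        (\<Sum>i\<le>m. (sqrt \<bar>fps_nth f i\<bar> * \<bar>fps_nth g (m - i)\<bar>)\<^sup>2)"
      by (rule Cauchy_Schwarz_ineq_sum)
    also have "\<dots> = (\<Sum>i\<le>m. \<bar>fps_nth f i\<bar>) * ?C m"
      by (simp add: power_mult_distrib)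
    also have "\<dots> \<le> l1_norm f * ?C m"
      unfolding l1_norm_def using assms
      by (intro mult_right_mono sum_le_suminf sum_nonneg) (auto simp: abs_summable_def)
    finally show ?thesis .
  qed
  have C': "(\<lambda>m. l1_norm f * ?C m) sums (l1_norm f * (l1_norm f * energy g))"
    by (rule sums_mult[OF C])
  show *: "sq_summable (f * g)"
    unfolding sq_summable_def
    by (rule summable_comparison_test'[OF sums_summable[OF C'], of 0]) (use le in auto)
  have "energy (f * g) \<le> l1_norm f * (l1_norm f * energy g)"
    unfolding energy_def[of "f * g"] sums_unique[OF C']
    by (rule suminf_le[OF le]) (use * C' in \<open>auto simp: sq_summable_def sums_iff\<close>)
  then show "energy (f * g) \<le> (l1_norm f)\<^sup>2 * energy g" by (simp add: power2_eq_square mult.assoc)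
qed

text \<open>
  Convergence in \<open>\<ell>\<^sup>2\<close> along a filter.  The first conjunct excludes the arbitrary value that the
  energy has when its series diverges.
\<close>

definition energy_tendsto :: "('i \<Rightarrow> real fps) \<Rightarrow> real fps \<Rightarrow> 'i filter \<Rightarrow> bool" where
  "energy_tendsto f g F \<longleftrightarrow>
     (\<forall>\<^sub>F i in F. sq_summable (f i - g)) \<and> ((\<lambda>i. energy (f i - g)) \<longlongrightarrow> 0) F"

lemma energy_tendstoI_bound:
  assumes "\<forall>\<^sub>F i in F. sq_summable (f i - g) \<and> energy (f i - g) \<le> B i" "(B \<longlongrightarrow> 0) F"
  shows "energy_tendsto f g F"
  unfolding energy_tendsto_def
proof
  show "\<forall>\<^sub>F i in F. sq_summable (f i - g)" using assms(1) by eventually_elim simp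
  show "((\<lambda>i. energy (f i - g)) \<longlongrightarrow> 0) F"
    by (rule tendsto_sandwich[OF _ _ tendsto_const assms(2)])
       (use assms(1) in \<open>auto elim!: eventually_mono simp: energy_nonneg\<close>)
qed

lemma energy_tendsto_const [simp]: "energy_tendsto (\<lambda>_. f) f F"
  by (simp add: energy_tendsto_def)

lemma energy_tendsto_add:
  assumes "energy_tendsto f f' F" "energy_tendsto g g' F"
  shows "energy_tendsto (\<lambda>i. f i + g i) (f' + g') F"
proof (rule energy_tendstoI_bound)
  show "((\<lambda>i. 2 * energy (f i - f') + 2 * energy (g i - g')) \<longlongrightarrow> 0) F"
    using assms by (auto simp: energy_tendsto_def intro!: tendsto_eq_intros)
  show "\<forall>\<^sub>F i in F. sq_summable (f i + g i - (f' + g')) \<and>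
          energy (f i + g i - (f' + g')) \<le> 2 * energy (f i - f') + 2 * energy (g i - g')"
    using assms[unfolded energy_tendsto_def, THEN conjunct1]
  proof eventually_elim
    case (elim i)
    have e: "f i + g i - (f' + g') = (f i - f') + (g i - g')" by simp
    show ?case unfolding e using elim by (auto intro: sq_summable_add energy_add)
  qed
qed

lemma energy_tendsto_sum:
  assumes "finite A" "\<And>j. j \<in> A \<Longrightarrow> energy_tendsto (f j) (g j) F"
  shows "energy_tendsto (\<lambda>i. \<Sum>j\<in>A. f j i) (\<Sum>j\<in>A. g j) F"
  using assms by (induction A rule: finite_induct) (auto intro!: energy_tendsto_add)

text \<open>
  This is the product rule \<open>f\<^sub>i g\<^sub>i - f g = f\<^sub>i (g\<^sub>i - g) + g (f\<^sub>i - f)\<close> with Young's inequality for each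
  term.  Convergence of the \<open>f\<^sub>i\<close> in \<open>\<ell>\<^sup>2\<close> does not control their \<open>\<ell>\<^sup>1\<close> norms, whence the bound \<open>B\<close>.
\<close>

lemma energy_tendsto_mult:
  assumes f: "\<forall>\<^sub>F i in F. abs_summable (f i) \<and> l1_norm (f i) \<le> B"
    and ff: "energy_tendsto f f' F" and g: "energy_tendsto g g' F" and g': "abs_summable g'"
  shows "energy_tendsto (\<lambda>i. f i * g i) (f' * g') F"
proof (rule energy_tendstoI_bound)
  show "((\<lambda>i. 2 * (B\<^sup>2 * energy (g i - g')) + 2 * ((l1_norm g')\<^sup>2 * energy (f i - f'))) \<longlongrightarrow> 0) F"
    using ff g by (auto simp: energy_tendsto_def intro!: tendsto_eq_intros)
  show "\<forall>\<^sub>F i in F. sq_summable (f i * g i - f' * g') \<and> energy (f i * g i - f' * g') \<le> 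
         2 * (B\<^sup>2 * energy (g i - g')) + 2 * ((l1_norm g')\<^sup>2 * energy (f i - f'))"
    using f ff[unfolded energy_tendsto_def, THEN conjunct1] g[unfolded energy_tendsto_def, THEN conjunct1]
  proof eventually_elim
    case (elim i)
    have e: "f i * g i - f' * g' = f i * (g i - g') + g' * (f i - f')" by (simp add: algebra_simps)
    have s: "sq_summable (f i * (g i - g'))" "sq_summable (g' * (f i - f'))"
      using elim g' by (auto intro: sq_summable_mult)
    have "energy (f i * (g i - g')) \<le> (l1_norm (f i))\<^sup>2 * energy (g i - g')"
      using elim by (intro energy_mult_le) auto
    also have "\<dots> \<le> B\<^sup>2 * energy (g i - g')"
      using elim by (intro mult_right_mono power_mono energy_nonneg l1_norm_nonneg) auto
    finally have 1: "energy (f i * (g i - g')) \<le> B\<^sup>2 * energy (g i - g')" .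
    have 2: "energy (g' * (f i - f')) \<le> (l1_norm g')\<^sup>2 * energy (f i - f')"
      using elim g' by (intro energy_mult_le) auto
    show ?case unfolding e using s sq_summable_add[OF s] energy_add[OF s] 1 2 by auto
  qed
qed

lemma energy_tendsto_mult_left:
  assumes "abs_summable f" "energy_tendsto g g' F"
  shows "energy_tendsto (\<lambda>i. f * g i) (f * g') F"
proof (rule energy_tendstoI_bound)
  show "((\<lambda>i. (l1_norm f)\<^sup>2 * energy (g i - g')) \<longlongrightarrow> 0) F"
    using assms by (auto simp: energy_tendsto_def intro!: tendsto_eq_intros)
  show "\<forall>\<^sub>F i in F. sq_summable (f * g i - f * g') \<and> 
      energy (f * g i - f * g') \<le> (l1_norm f)\<^sup>2 * energy (g i - g')"
    using assms(2)[unfolded energy_tendsto_def, THEN conjunct1]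
    by eventually_elim 
      (auto simp: right_diff_distrib[symmetric] intro!: energy_mult_le sq_summable_mult assms)
qed

lemma energy_tendsto_power:
  assumes f: "\<forall>\<^sub>F i in F. abs_summable (f i) \<and> l1_norm (f i) \<le> B" and "energy_tendsto f 1 F"
  shows "energy_tendsto (\<lambda>i. f i ^ N) 1 F"
proof (induction N)
  case (Suc N)
  show ?case using energy_tendsto_mult[OF f assms(2) Suc.IH] by simp
qed simp

lemma energy_tendsto_scale:
  assumes "energy_tendsto f g F" "(u \<longlongrightarrow> 1) F" "sq_summable g"
  shows "energy_tendsto (\<lambda>i. fps_const (u i) * f i) g F"
proof (rule energy_tendstoI_bound)
  show "((\<lambda>i. 2 * ((u i)\<^sup>2 * energy (f i - g)) + 2 * ((u i - 1)\<^sup>2 * energy g)) \<longlongrightarrow> 0) F"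
    using assms by (auto simp: energy_tendsto_def intro!: tendsto_eq_intros)
  show "\<forall>\<^sub>F i in F. sq_summable (fps_const (u i) * f i - g) \<and> energy (fps_const (u i) * f i - g)
        \<le> 2 * ((u i)\<^sup>2 * energy (f i - g)) + 2 * ((u i - 1)\<^sup>2 * energy g)"
    using assms(1)[unfolded energy_tendsto_def, THEN conjunct1]
  proof eventually_elim
    case (elim i)
    have e: "fps_const (u i) * f i - g = fps_const (u i) * (f i - g) + fps_const (u i - 1) * g"
      by (simp add: fps_eq_iff algebra_simps)
    have s: "sq_summable (fps_const (u i) * (f i - g))" "sq_summable (fps_const (u i - 1) * g)"
      using elim assms by (auto intro: sq_summable_cmult)
    show ?case unfolding e 
      using sq_summable_add[OF s] energy_add[OF s] elim assms by (auto simp only: energy_cmult)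
  qed
qed

text \<open>
  Weights \<open>r\<^sup>k\<close> give the dilated series \<open>f(r z)\<close>, and weights \<open>1\<close> or \<open>0\<close> give truncations.
\<close>

definition weighted :: "(nat \<Rightarrow> real) \<Rightarrow> real fps \<Rightarrow> real fps" where
  "weighted w f = Abs_fps (\<lambda>k. w k * fps_nth f k)"

lemma weighted_nth [simp]: "fps_nth (weighted w f) k = w k * fps_nth f k"
  by (simp add: weighted_def)

lemma weighted_sum: "weighted w (\<Sum>j\<in>A. f j) = (\<Sum>j\<in>A. weighted w (f j))"
  by (simp add: fps_eq_iff fps_sum_nth sum_distrib_left)

lemma weighted_lag:
  "weighted w (fps_const a * (fps_X ^ j * f)) = fps_const a * (fps_X ^ j * weighted (\<lambda>k. w (k + j)) f)"
  by (simp add: fps_eq_iff fps_X_power_mult_nth)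

text \<open>
  Geometric weights dilate the variable, and dilation is a ring homomorphism.
\<close>

lemma weighted_geometric_power: "weighted (\<lambda>k. r ^ k) (f ^ N) = weighted (\<lambda>k. r ^ k) f ^ N"
proof -
  have "weighted (\<lambda>k. r ^ k) g = g oo (fps_const r * fps_X)" for g
    by (simp add: fps_compose_linear weighted_def)
  then show ?thesis by (simp add: fps_compose_power[symmetric])
qed

definition truncated :: "nat \<Rightarrow> real fps \<Rightarrow> real fps" where
  "truncated n = weighted (\<lambda>k. if k < n then 1 else 0)"

lemma truncated_nth [simp]: "fps_nth (truncated n f) k = (if k < n then fps_nth f k else 0)"
  by (simp add: truncated_def)

lemma truncated_Suc: "truncated (Suc n) f = truncated n f + fps_const (fps_nth f n) * fps_X ^ n"
  by (auto simp: fps_eq_iff less_Suc_eq)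

text \<open>
  Young's inequality, applied to the tail of \<open>a\<close>.
\<close>

lemma truncated_mult_tendsto:
  assumes a: "abs_summable a" and f: "sq_summable f"
  shows "energy_tendsto (\<lambda>n. truncated n a * f) (a * f) sequentially"
proof (rule energy_tendstoI_bound)
  let ?t = "\<lambda>n. truncated n a - a"
  have sums: "(\<lambda>k. \<bar>fps_nth (?t n) k\<bar>) sums (l1_norm a - (\<Sum>k<n. \<bar>fps_nth a k\<bar>))" for n
  proof -
    have e: "\<bar>fps_nth (?t n) k\<bar> = \<bar>fps_nth a k\<bar> - (if k < n then \<bar>fps_nth a k\<bar> else 0)" for k
      by simp
    have "(\<lambda>k. if k < n then \<bar>fps_nth a k\<bar> else 0) sums (\<Sum>k<n. \<bar>fps_nth a k\<bar>)"
      using sums_If_finite_set[of "{..<n}" "\<lambda>k. \<bar>fps_nth a k\<bar>"] by simp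
    moreover have "(\<lambda>k. \<bar>fps_nth a k\<bar>) sums l1_norm a"
      using a by (simp add: abs_summable_def l1_norm_def summable_sums)
    ultimately show ?thesis unfolding e by (intro sums_diff)
  qed
  then have t: "abs_summable (?t n)" "l1_norm (?t n) = l1_norm a - (\<Sum>k<n. \<bar>fps_nth a k\<bar>)" for n
    using sums[of n] unfolding abs_summable_def l1_norm_def[of "?t n"] sums_iff by blast+
  have "(\<lambda>n. l1_norm a - (\<Sum>k<n. \<bar>fps_nth a k\<bar>)) \<longlonglongrightarrow> l1_norm a - l1_norm a"
    using a by (intro tendsto_intros) (auto simp: abs_summable_def l1_norm_def intro: summable_LIMSEQ)
  then have "(\<lambda>n. l1_norm (?t n)) \<longlonglongrightarrow> 0" by (simp add: t)
  then show "(\<lambda>n. (l1_norm (?t n))\<^sup>2 * energy f) \<longlonglongrightarrow> 0" 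
    by (auto intro!: tendsto_eq_intros)
  show "\<forall>\<^sub>F n in sequentially. sq_summable (truncated n a * f - a * f) \<and>
     energy (truncated n a * f - a * f) \<le> (l1_norm (?t n))\<^sup>2 * energy f"
    unfolding left_diff_distrib[symmetric]
    by (intro always_eventually allI conjI sq_summable_mult energy_mult_le t f)
qed

section \<open>Damping a power series against its inverse\<close>

text \<open>
  Reverse the summation index, so that \<open>l\<close> dominates and each term tends to \<open>0\<close>; then Tannery's
  theorem exchanges limit and sum.
\<close>

lemma null_convolution:
  fixes c l :: "nat \<Rightarrow> real"
  assumes c: "c \<longlonglongrightarrow> 0" and l: "summable (\<lambda>k. \<bar>l k\<bar>)"
  shows "(\<lambda>m. \<Sum>k\<le>m. c k * \<bar>l (m - k)\<bar>) \<longlonglongrightarrow> 0"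
proof -
  obtain B where B: "\<And>k. \<bar>c k\<bar> \<le> B"
    using convergent_imp_Bseq[OF convergentI[OF c]] by (auto simp: Bseq_def)
  define a where "a j m = (if j \<le> m then c (m - j) * \<bar>l j\<bar> else 0)" for j m :: nat
  have "((\<lambda>m. \<Sum>j. a j m) \<longlongrightarrow> (\<Sum>j. 0)) sequentially"
  proof (rule tannerys_theorem[THEN conjunct2, THEN conjunct2])
    fix j
    have "(\<lambda>m. a j (m + j)) \<longlonglongrightarrow> 0"
      unfolding a_def using tendsto_mult_right[OF c, of "\<bar>l j\<bar>"] by (simp add: mult.commute)
    then show "(\<lambda>m. a j m) \<longlonglongrightarrow> 0" by (rule LIMSEQ_offset)
  next
    show "summable (\<lambda>j. B * \<bar>l j\<bar>)" using l by (rule summable_mult)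
    have "norm (a j m) \<le> B * \<bar>l j\<bar>" for j m
      using B[of "m - j"] order.trans[OF abs_ge_zero B[of 0]]
      by (auto simp: a_def abs_mult intro!: mult_right_mono)
    then show "\<forall>\<^sub>F (k, n) in at_top \<times>\<^sub>F sequentially. norm (a k n) \<le> B * \<bar>l k\<bar>"
      by (intro always_eventually) auto
  qed auto
  moreover have "(\<Sum>j. a j m) = (\<Sum>k\<le>m. c k * \<bar>l (m - k)\<bar>)" for m
  proof -
    have "(\<Sum>j. a j m) = (\<Sum>j\<le>m. a j m)" by (rule suminf_finite) (auto simp: a_def)
    also have "\<dots> = (\<Sum>k\<le>m. a (m - k) m)" 
      by (rule sum.reindex_bij_witness[of _ "\<lambda>k. m - k" "\<lambda>k. m - k"]) auto
    also have "\<dots> = (\<Sum>k\<le>m. c k * \<bar>l (m - k)\<bar>)" by (rule sum.cong) (auto simp: a_def)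
    finally show ?thesis .
  qed
  ultimately show ?thesis by simp
qed

text \<open>
  The model is \<open>c = (1 - z)\<^sup>-\<^sup>\<eta>\<close> and \<open>l = (1 - z)\<^sup>\<eta>\<close> with \<open>0 < \<eta> < 1\<close>.  The argument
  rests on the sign pattern, the summability of \<open>l\<close> and the convergence of the \<open>c\<^sub>k\<close> to \<open>0\<close>.
\<close>

locale antipersistent_pair =
  fixes c l :: "real fps"
  assumes inv: "c * l = 1"
    and c0: "fps_nth c 0 = 1"
    and c_nonneg: "0 \<le> fps_nth c k"
    and l_nonpos: "0 < k \<Longrightarrow> fps_nth l k \<le> 0"
    and l_summable: "abs_summable l"
    and l_sum: "0 \<le> (\<Sum>k. fps_nth l k)"
    and c_null: "fps_nth c \<longlonglongrightarrow> 0"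
begin

lemma l0: "fps_nth l 0 = 1"
proof -
  have "fps_nth (c * l) 0 = 1" by (simp add: inv)
  then show ?thesis by (simp add: c0)
qed

text \<open>
  Subtracting \<open>w m\<close> times the vanishing coefficient of \<open>c l\<close> exposes the weight increments, which
  have a sign.
\<close>

lemma product_nth:
  assumes "0 < m"
  shows "fps_nth (weighted w c * l) m
    = (\<Sum>k\<le>m. (w k - w m) * (fps_nth c k * fps_nth l (m - k)))"
proof -
  have "fps_nth (c * l) m = 0" using assms by (simp add: inv)
  then have "(\<Sum>k\<le>m. w m * (fps_nth c k * fps_nth l (m - k))) = 0"
    by (simp add: fps_mult_nth atLeast0AtMost sum_distrib_left[symmetric])
  then show ?thesis
    by (simp add: fps_mult_nth atLeast0AtMost left_diff_distrib sum_subtractf mult.assoc)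
qed

lemma product_nth_nonpos:
  assumes "antimono w" "0 < m"
  shows "fps_nth (weighted w c * l) m \<le> 0"
  unfolding product_nth[OF assms(2)]
proof (rule sum_nonpos)
  fix k assume k: "k \<in> {..m}"
  show "(w k - w m) * (fps_nth c k * fps_nth l (m - k)) \<le> 0"
  proof (cases "k = m")
    case False
    then have "fps_nth c k * fps_nth l (m - k) \<le> 0"
      using k by (intro mult_nonneg_nonpos c_nonneg l_nonpos) auto
    then show ?thesis using k antimonoD[OF assms(1), of k m] by (simp add: mult_nonneg_nonpos)
  qed simp
qed

lemma product_nth_bound:
  assumes "antimono w" "0 < m"
  shows "\<bar>fps_nth (weighted w c * l) m\<bar>
    \<le> (w 0 - w m) * (\<Sum>k\<le>m. fps_nth c k * \<bar>fps_nth l (m - k)\<bar>)"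
proof -
  have "\<bar>fps_nth (weighted w c * l) m\<bar> 
      \<le> (\<Sum>k\<le>m. \<bar>(w k - w m) * (fps_nth c k * fps_nth l (m - k))\<bar>)"
    unfolding product_nth[OF assms(2)] by (rule sum_abs)
  also have "\<dots> \<le> (\<Sum>k\<le>m. (w 0 - w m) * (fps_nth c k * \<bar>fps_nth l (m - k)\<bar>))"
    using antimonoD[OF assms(1)] c_nonneg
    by (intro sum_mono) (auto simp: abs_mult intro!: mult_mono)
  finally show ?thesis by (simp add: sum_distrib_left)
qed

text \<open>
  All coefficients after the first are nonpositive, so their absolute sum is the first coefficient
  minus the total; and the total, being the product of the two sums, is nonnegative.
\<close>

lemma product_l1:
  assumes w: "antimono w" "\<And>k. 0 \<le> w k" and s: "abs_summable (weighted w c)"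
  shows "abs_summable (weighted w c * l)" and "l1_norm (weighted w c * l) \<le> 2 * w 0"
proof -
  let ?h = "\<lambda>m. fps_nth (weighted w c * l) m"
  have "(\<lambda>m. \<Sum>i\<le>m. fps_nth (weighted w c) i * fps_nth l (m - i)) sums
      ((\<Sum>k. fps_nth (weighted w c) k) * (\<Sum>k. fps_nth l k))"
    by (rule Cauchy_product_sums) (use s l_summable in \<open>auto simp: abs_summable_def\<close>)
  then have h: "?h sums ((\<Sum>k. fps_nth (weighted w c) k) * (\<Sum>k. fps_nth l k))"
    by (simp add: fps_mult_nth atLeast0AtMost)
  have "0 \<le> (\<Sum>k. fps_nth (weighted w c) k)"
    using s w c_nonneg unfolding abs_summable_def
    by (intro suminf_nonneg) (auto intro: summable_rabs_cancel)
  with h have pos: "0 \<le> suminf ?h" using l_sum by (simp add: sums_iff)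
  have abs: "\<bar>?h m\<bar> = (if m = 0 then 2 * ?h 0 else 0) - ?h m" for m
    using product_nth_nonpos[OF w(1), of m] w(2)[of 0] by (auto simp: c0 l0)
  have "(\<lambda>m. if m = 0 then 2 * ?h 0 else 0) sums (2 * ?h 0)"
    using sums_If_finite_set[of "{0::nat}" "\<lambda>m. 2 * ?h 0"] by simp
  then have "(\<lambda>m. \<bar>?h m\<bar>) sums (2 * ?h 0 - suminf ?h)"
    unfolding abs using h by (intro sums_diff) (auto simp: sums_iff)
  then show "abs_summable (weighted w c * l)" "l1_norm (weighted w c * l) \<le> 2 * w 0"
    using pos by (auto simp: abs_summable_def l1_norm_def sums_iff c0 l0)
qed

text \<open>
  In absolute value, the coefficients after the first are at most \<open>(w\<^sub>0 - w\<^sub>m) D\<^sub>m\<close> with \<open>D\<^sub>m \<longlonglongrightarrow> 0\<close>: for large \<open>m\<close> this is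
  small because of \<open>D\<^sub>m\<close>, and for the finitely many other \<open>m\<close> because the weights tend to \<open>1\<close>.  The
  uniform \<open>\<ell>\<^sup>1\<close> bound then makes the sum of squares small.
\<close>

lemma weighted_product_tendsto:
  fixes w :: "'i \<Rightarrow> nat \<Rightarrow> real"
  assumes w: "\<forall>\<^sub>F i in F. antimono (w i) \<and> (\<forall>k. 0 \<le> w i k \<and> w i k \<le> 1) \<and> abs_summable (weighted (w i) c)"
    and lim: "\<And>k. ((\<lambda>i. w i k) \<longlongrightarrow> 1) F"
  shows "energy_tendsto (\<lambda>i. weighted (w i) c * l) 1 F"
proof -
  define D where "D m = (\<Sum>k\<le>m. fps_nth c k * \<bar>fps_nth l (m - k)\<bar>)" for m
  have D: "D \<longlonglongrightarrow> 0" unfolding D_def 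
    by (rule null_convolution[OF c_null l_summable[unfolded abs_summable_def]])
  have D0: "0 \<le> D m" for m unfolding D_def by (intro sum_nonneg mult_nonneg_nonneg c_nonneg) auto
  have key: "\<forall>\<^sub>F i in F. sq_summable (weighted (w i) c * l - 1) \<and>
                energy (weighted (w i) c * l - 1) \<le> 3 * e" if e: "0 < e" for e
  proof -
    \<comment> \<open>From \<open>N\<close> on the bound \<open>D\<close> is small; below \<open>N\<close> only finitely many weights matter.\<close>
    obtain N where N: "\<And>m. m \<ge> N \<Longrightarrow> D m < e"
      using order_tendstoD(2)[OF D e] by (auto simp: eventually_sequentially)
    have "\<forall>\<^sub>F i in F. \<forall>m\<in>{..<N}. (w i 0 - w i m) * D m < e"
    proof (rule eventually_ball_finite)
      show "\<forall>m\<in>{..<N}. \<forall>\<^sub>F i in F. (w i 0 - w i m) * D m < e"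
      proof
        fix m
        have "((\<lambda>i. (w i 0 - w i m) * D m) \<longlongrightarrow> (1 - 1) * D m) F"
          by (intro tendsto_intros lim)
        then show "\<forall>\<^sub>F i in F. (w i 0 - w i m) * D m < e"
          using e by (auto intro: order_tendstoD(2))
      qed
    qed simp
    moreover have "((\<lambda>i. (w i 0 - 1)\<^sup>2) \<longlongrightarrow> (1 - 1)\<^sup>2) F" by (intro tendsto_intros lim)
    then have "\<forall>\<^sub>F i in F. (w i 0 - 1)\<^sup>2 < e" using e by (intro order_tendstoD(2)) auto
    ultimately show ?thesis using w
    proof eventually_elim
      case (elim i)
      let ?h = "\<lambda>m. fps_nth (weighted (w i) c * l) m"
      have am: "antimono (w i)" and wb: "\<And>k. 0 \<le> w i k" "\<And>k. w i k \<le> 1" using elim by auto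
      have s: "abs_summable (weighted (w i) c * l)" 
        using product_l1[OF am wb(1)] elim by auto
      have "l1_norm (weighted (w i) c * l) \<le> 2 * w i 0"
        using product_l1[OF am wb(1)] elim by auto
      also have "\<dots> \<le> 2" using wb(2)[of 0] by simp
      finally have s2: "l1_norm (weighted (w i) c * l) \<le> 2" .
      have small: "\<bar>?h m\<bar> \<le> e" if "0 < m" for m
      proof (cases "m < N")
        case True
        then show ?thesis using product_nth_bound[OF am that] elim
          by (force simp: D_def)
      next
        case False
        have "(w i 0 - w i m) * D m \<le> 1 * D m"
          using wb(2)[of 0] wb(1)[of m] D0 by (intro mult_right_mono) auto
        then show ?thesis using product_nth_bound[OF am that] N[of m] False by (simp add: D_def)
      qed
      have le: "(fps_nth (weighted (w i) c * l - 1) m)\<^sup>2 \<le> (if m = 0 then e else 0) + e * \<bar>?h m\<bar>" for m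
      proof (cases "m = 0")
        case True
        then show ?thesis using elim e by (auto simp: c0 l0 intro: add_increasing2)
      next
        case False
        then show ?thesis using mult_right_mono[OF small[of m], of "\<bar>?h m\<bar>"] 
          by (simp add: power2_eq_square)
      qed
      have "(\<lambda>m. if m = 0 then e else 0) sums e"
        using sums_If_finite_set[of "{0::nat}" "\<lambda>m. e"] by simp
      then have S: "(\<lambda>m. (if m = 0 then e else 0) + e * \<bar>?h m\<bar>) sums (e + e * l1_norm (weighted (w i) c * l))"
        using s by (intro sums_add sums_mult) (auto simp: abs_summable_def l1_norm_def)
      have sq: "sq_summable (weighted (w i) c * l - 1)"
        unfolding sq_summable_def
        by (rule summable_comparison_test'[OF sums_summable[OF S], of 0]) (use le in auto)
      have "energy (weighted (w i) c * l - 1) \<le> e + e * l1_norm (weighted (w i) c * l)"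
        unfolding energy_def sums_unique[OF S]
        by (rule suminf_le[OF le]) (use sq S in \<open>auto simp: sq_summable_def sums_iff\<close>)
      also have "\<dots> \<le> e + e * 2" using s2 e by simp
      finally show ?case using sq by simp
    qed
  qed
  show ?thesis unfolding energy_tendsto_def
  proof
    show ev: "\<forall>\<^sub>F i in F. sq_summable (weighted (w i) c * l - 1)"
      using key[of 1] by (auto elim: eventually_mono)
    show "((\<lambda>i. energy (weighted (w i) c * l - 1)) \<longlongrightarrow> 0) F"
    proof (rule tendstoI)
      fix e :: real assume "0 < e"
      then have "\<forall>\<^sub>F i in F. sq_summable (weighted (w i) c * l - 1) \<and>
                energy (weighted (w i) c * l - 1) \<le> 3 * (e / 4)" by (intro key) auto
      then show "\<forall>\<^sub>F i in F. dist (energy (weighted (w i) c * l - 1)) 0 < e"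
        by eventually_elim (use \<open>0 < e\<close> in \<open>auto simp: energy_nonneg\<close>)
    qed
  qed
qed

text \<open>
  The offset \<open>j\<close> arises when a truncation is moved past a lag of order \<open>j\<close>.
\<close>

lemma truncation_tendsto:
  "energy_tendsto (\<lambda>n. weighted (\<lambda>k. if k + j < n then 1 else 0) c * l) 1 sequentially"
proof (rule weighted_product_tendsto)
  show "\<forall>\<^sub>F n in sequentially. antimono (\<lambda>k. if k + j < n then 1 else 0::real) \<and>
      (\<forall>k. 0 \<le> (if k + j < n then 1 else 0::real) \<and> (if k + j < n then 1 else 0::real) \<le> 1) \<and>
      abs_summable (weighted (\<lambda>k. if k + j < n then 1 else 0) c)"
  proof (intro always_eventually allI conjI)
    fix n
    show "abs_summable (weighted (\<lambda>k. if k + j < n then 1 else 0) c)"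
      by (rule abs_summable_finite_support[of n]) auto
  qed (auto simp: antimono_def)
  show "(\<lambda>n. if k + j < n then 1 else 0::real) \<longlonglongrightarrow> 1" for k
    by (rule tendsto_eventually, rule eventually_mono[OF eventually_gt_at_top[of "k + j"]]) simp
qed

lemma eventually_Abel_weights:
  assumes s: "\<And>r. 0 < r \<Longrightarrow> r < 1 \<Longrightarrow> abs_summable (weighted (\<lambda>k. r ^ k) c)"
  shows "\<forall>\<^sub>F r in at_left (1::real). antimono (\<lambda>k. r ^ k) \<and> (\<forall>k. 0 \<le> r ^ k \<and> r ^ k \<le> 1) \<and>
      abs_summable (weighted (\<lambda>k. r ^ k) c)"
proof -
  have "\<forall>\<^sub>F r in at_left (1::real). 0 < r \<and> r < 1"
    by (auto simp: eventually_at_left_field intro: exI[of _ 0])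
  then show ?thesis
    by eventually_elim (auto simp: antimono_def power_decreasing power_le_one s)
qed

lemma Abel_power_tendsto:
  assumes s: "\<And>r. 0 < r \<Longrightarrow> r < 1 \<Longrightarrow> abs_summable (weighted (\<lambda>k. r ^ k) c)"
  shows "energy_tendsto (\<lambda>r. (weighted (\<lambda>k. r ^ k) c * l) ^ N) 1 (at_left 1)"
proof (rule energy_tendsto_power)
  show "energy_tendsto (\<lambda>r. weighted (\<lambda>k. r ^ k) c * l) 1 (at_left 1)"
  proof (rule weighted_product_tendsto, rule eventually_Abel_weights, rule s)
    show "((\<lambda>r. r ^ k) \<longlongrightarrow> 1) (at_left (1::real))" for k
      by (auto intro!: tendsto_eq_intros)
  qed
  show "\<forall>\<^sub>F r in at_left 1. abs_summable (weighted (\<lambda>k. r ^ k) c * l) \<and> 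
      l1_norm (weighted (\<lambda>k. r ^ k) c * l) \<le> 2"
  proof (rule eventually_mono[OF eventually_Abel_weights])
    fix r assume "antimono (\<lambda>k. r ^ k) \<and> (\<forall>k. 0 \<le> r ^ k \<and> r ^ k \<le> 1) \<and>
      abs_summable (weighted (\<lambda>k. r ^ k) c)"
    then show "abs_summable (weighted (\<lambda>k. r ^ k) c * l) \<and> 
        l1_norm (weighted (\<lambda>k. r ^ k) c * l) \<le> 2"
      using product_l1[of "\<lambda>k. r ^ k"] by simp
  qed (rule s)
qed

end

section \<open>Coefficients of the seasonal difference operator\<close>

text \<open>
  The expansion of \<open>(1 - z\<^sup>s)\<^sup>D\<close>, as a composition so that the laws of exponents are inherited from
  the binomial series.
\<close>

definition seasonal_binomial :: "nat \<Rightarrow> real \<Rightarrow> real fps" where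
  "seasonal_binomial s D = (fps_binomial D oo (- fps_X)) oo fps_X ^ s"

lemma seasonal_binomial_nth:
  "fps_nth (seasonal_binomial s D) n =
     (if s dvd n then pochhammer (- D) (n div s) / fact (n div s) else 0)"
proof -
  have "(-1) ^ k * (D gchoose k) = pochhammer (- D) k / fact k" for k
    by (simp add: gbinomial_pochhammer mult.assoc[symmetric] power_mult_distrib[symmetric])
  then show ?thesis
    by (simp add: seasonal_binomial_def fps_nth_compose_X_power fps_compose_uminus')
qed

lemma seasonal_binomial_add:
  assumes "1 \<le> s"
  shows "seasonal_binomial s (a + b) = seasonal_binomial s a * seasonal_binomial s b"
  using assms by (simp add: seasonal_binomial_def fps_binomial_add_mult fps_compose_mult_distrib)

lemma seasonal_binomial_zero [simp]: "seasonal_binomial s 0 = 1"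
  by (simp add: seasonal_binomial_def)

lemma seasonal_binomial_power:
  assumes "1 \<le> s"
  shows "seasonal_binomial s (of_nat N * D) = seasonal_binomial s D ^ N"
  by (induction N) (simp_all add: distrib_right seasonal_binomial_add[OF assms])

lemma seasonal_binomial_inverse:
  assumes "1 \<le> s"
  shows "seasonal_binomial s (- D) * seasonal_binomial s D = 1"
  using seasonal_binomial_add[OF assms, of "- D" D] by simp

lemma seasonal_reindex:
  fixes s :: nat
  assumes "1 \<le> s"
  shows "strict_mono ((*) s)" "n \<notin> range ((*) s) \<Longrightarrow> \<not> s dvd n"
  using assms by (auto intro!: strict_monoI mult_less_mono2)

text \<open>
  The partial sums of the alternating binomial coefficients are again binomial coefficients, those of
  \<open>D - 1\<close> with alternating signs, hence nonnegative.  As all terms but the first are nonpositive, this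
  bounds the absolute partial sums by \<open>2\<close>.
\<close>

lemma binomial_l1:
  fixes D :: real
  assumes "0 \<le> D" "D \<le> 1"
  defines "a \<equiv> \<lambda>k. pochhammer (- D) k / fact k"
  shows "0 < k \<Longrightarrow> a k \<le> 0" and "summable (\<lambda>k. \<bar>a k\<bar>)" and "0 \<le> suminf a"
proof -
  have neg: "a k \<le> 0" if "0 < k" for k
  proof (cases k)
    case (Suc n)
    have "0 \<le> pochhammer (1 - D) n" 
      unfolding pochhammer_prod using assms by (intro prod_nonneg) auto
    then show ?thesis using assms 
      by (simp add: a_def Suc pochhammer_rec mult_nonneg_nonneg divide_nonneg_nonneg)
  qed (use that in simp)
  then show "0 < k \<Longrightarrow> a k \<le> 0" .
  have a: "a k = (D gchoose k) * (-1) ^ k" for k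
    by (simp add: a_def gbinomial_pochhammer power_mult_distrib[symmetric])
  have part: "0 \<le> (\<Sum>k\<le>m. a k)" for m
  proof -
    have "(\<Sum>k\<le>m. a k) = (-1) ^ m * (D - 1 gchoose m)"
      unfolding a by (rule gbinomial_sum_lower_neg)
    also have "\<dots> = pochhammer (1 - D) m / fact m"
      by (simp add: gbinomial_pochhammer mult.assoc[symmetric] power_mult_distrib[symmetric])
    also have "\<dots> \<ge> 0" 
      unfolding pochhammer_prod using assms by (intro divide_nonneg_nonneg prod_nonneg) auto
    finally show ?thesis .
  qed
  have "a 0 = 1" by (simp add: a_def)
  then have "\<bar>a k\<bar> = (if k = 0 then 2 else 0) - a k" for k
    using neg[of k] by auto
  then have "(\<Sum>k\<le>m. \<bar>a k\<bar>) \<le> 2" for m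
    using part[of m] by (simp add: sum_subtractf)
  then show sum: "summable (\<lambda>k. \<bar>a k\<bar>)"
    by (intro bounded_imp_summable[of _ 2]) auto
  then have "summable a" by (rule summable_rabs_cancel)
  then have "(\<lambda>m. \<Sum>k\<le>m. a k) \<longlonglongrightarrow> suminf a" by (rule summable_LIMSEQ')
  then show "0 \<le> suminf a" by (rule LIMSEQ_le_const) (use part in auto)
qed

lemma seasonal_binomial_l1:
  assumes s: "1 \<le> s" and "0 \<le> D" "D \<le> 1"
  shows "abs_summable (seasonal_binomial s D)" "0 \<le> (\<Sum>k. fps_nth (seasonal_binomial s D) k)"
proof -
  have n: "fps_nth (seasonal_binomial s D) (s * k) = pochhammer (- D) k / fact k" for k
    using s by (simp add: seasonal_binomial_nth)
  have z: "fps_nth (seasonal_binomial s D) k = 0" if "k \<notin> range ((*) s)" for k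
    using seasonal_reindex(2)[OF s that] by (simp add: seasonal_binomial_nth)
  show "abs_summable (seasonal_binomial s D)"
    unfolding abs_summable_def
    using summable_mono_reindex[OF seasonal_reindex(1)[OF s], of "\<lambda>k. \<bar>fps_nth (seasonal_binomial s D) k\<bar>"]
      binomial_l1(2)[OF assms(2,3)] z by (simp add: n)
  show "0 \<le> (\<Sum>k. fps_nth (seasonal_binomial s D) k)"
    using suminf_mono_reindex[OF seasonal_reindex(1)[OF s], of "fps_nth (seasonal_binomial s D)"]
      binomial_l1(3)[OF assms(2,3)] z by (simp add: n)
qed

text \<open>
  The coefficients are asymptotic to \<open>k\<^sup>D\<^sup>-\<^sup>1 / \<Gamma>(D)\<close>.
\<close>

lemma binomial_null:
  fixes D :: real
  assumes "0 < D" "D < 1"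
  shows "(\<lambda>k. pochhammer D k / fact k) \<longlonglongrightarrow> 0"
proof -
  let ?e = "\<lambda>n. exp ((- D + 1) * ln (real n))"
  have "(\<lambda>n. (- D gchoose n) / ((-1) ^ n / ?e n)) \<longlonglongrightarrow> inverse (Gamma D)"
    using gbinomial_asymptotic[of "- D"] by simp
  moreover have "(- D gchoose n) / ((-1) ^ n / ?e n) = pochhammer D n / fact n * ?e n" for n
    by (simp add: gbinomial_pochhammer)
  ultimately have "(\<lambda>n. pochhammer D n / fact n * ?e n) \<longlonglongrightarrow> inverse (Gamma D)"
    by simp
  moreover have "(\<lambda>n. inverse (?e n)) \<longlonglongrightarrow> 0"
    using assms by real_asymp
  ultimately have "(\<lambda>n. pochhammer D n / fact n * ?e n * inverse (?e n)) \<longlonglongrightarrow> inverse (Gamma D) * 0"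
    by (rule tendsto_mult)
  moreover have "pochhammer D n / fact n * ?e n * inverse (?e n) = pochhammer D n / fact n" for n
    using exp_not_eq_zero[of "(- D + 1) * ln (real n)"] by (simp add: mult.assoc del: exp_not_eq_zero)
  ultimately show ?thesis unfolding mult_zero_right by (simp only:)
qed

lemma antipersistent_seasonal_binomial:
  assumes s: "1 \<le> s" and D: "0 < D" "D < 1"
  shows "antipersistent_pair (seasonal_binomial s (- D)) (seasonal_binomial s D)"
proof
  show "seasonal_binomial s (- D) * seasonal_binomial s D = 1"
    by (rule seasonal_binomial_inverse[OF s])
  show "fps_nth (seasonal_binomial s (- D)) 0 = 1" by (simp add: seasonal_binomial_nth)
  show "0 \<le> fps_nth (seasonal_binomial s (- D)) k" for k
    using D by (auto simp: seasonal_binomial_nth pochhammer_prod intro!: divide_nonneg_nonneg prod_nonneg)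
  show "fps_nth (seasonal_binomial s D) k \<le> 0" if "0 < k" for k
    using that binomial_l1(1)[of D "k div s"] D by (auto simp: seasonal_binomial_nth elim!: dvdE)
  show "abs_summable (seasonal_binomial s D)" "0 \<le> (\<Sum>k. fps_nth (seasonal_binomial s D) k)"
    using seasonal_binomial_l1[OF s, of D] D by auto
  show "fps_nth (seasonal_binomial s (- D)) \<longlonglongrightarrow> 0"
  proof (rule tendsto_rabs_zero_cancel, rule tendsto_sandwich[OF _ _ tendsto_const])
    have "filterlim (\<lambda>k. k div s) at_top at_top"
      using s filterlim_at_top_div_const_nat by auto
    then show "(\<lambda>k. \<bar>pochhammer D (k div s) / fact (k div s)\<bar>) \<longlonglongrightarrow> 0"
      using tendsto_rabs_zero[OF filterlim_compose[OF binomial_null[OF D]]] by blast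
  qed (auto simp: seasonal_binomial_nth)
qed

section \<open>Expansions in the unit disc\<close>

lemma disc_expansion_unique:
  assumes "disc_expansion f a" "disc_expansion f b"
  shows "a = b"
proof -
  define F where "F a = Abs_fps (\<lambda>k. complex_of_real (a k))" for a
  have "f has_fps_expansion F a" if "disc_expansion f a" for a
  proof -
    have sums: "(\<lambda>k. fps_nth (F a) k * z ^ k) sums f z" if "norm z < 1" for z
      using \<open>disc_expansion f a\<close> that by (simp add: disc_expansion_def F_def)
    have "fps_conv_radius (F a) \<ge> 1"
      unfolding fps_conv_radius_def one_ereal_def
    proof (rule conv_radius_geI_ex')
      fix r :: real assume "0 < r" "ereal r < ereal 1"
      then show "summable (\<lambda>n. fps_nth (F a) n * of_real r ^ n)"
        using sums[of "of_real r"] by (auto intro: sums_summable)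
    qed
    moreover have "\<forall>\<^sub>F z in nhds 0. eval_fps (F a) z = f z"
    proof -
      have "\<forall>\<^sub>F z in nhds 0. z \<in> ball (0::complex) 1" by (rule eventually_nhds_in_open) auto
      then show ?thesis
        by eventually_elim (use sums in \<open>auto simp: eval_fps_def sums_iff\<close>)
    qed
    ultimately show ?thesis
      unfolding has_fps_expansion_def by (auto intro: less_le_trans[of 0 1])
  qed
  from fps_expansion_unique_complex[OF this[OF assms(1)] this[OF assms(2)]]
  show ?thesis by (auto simp: F_def fps_eq_iff)
qed

lemma disc_expansion_abs_summable:
  fixes z :: complex
  assumes "disc_expansion f a" "norm z < 1"
  shows "summable (\<lambda>k. norm (of_real (a k) * z ^ k))"
proof -
  define r where "r = (1 + norm z) / 2"
  have r: "norm z < r" "r < 1" "0 < r" using assms(2) norm_ge_zero[of z] by (auto simp: r_def simp del: norm_ge_zero)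
  have "summable (\<lambda>k. of_real (a k) * (of_real r :: complex) ^ k)"
    using assms(1)[unfolded disc_expansion_def, rule_format, of "of_real r"] r
    by (intro sums_summable) auto
  moreover have "norm z < norm (of_real r :: complex)" using r by simp
  ultimately show ?thesis by (rule powser_insidea)
qed

lemma disc_expansion_mult:
  assumes "disc_expansion f (fps_nth a)" "disc_expansion g (fps_nth b)"
  shows "disc_expansion (\<lambda>z. f z * g z) (fps_nth (a * b))"
  unfolding disc_expansion_def
proof (intro allI impI)
  fix z :: complex assume z: "norm z < 1"
  let ?a = "\<lambda>k. of_real (fps_nth a k) * z ^ k" and ?b = "\<lambda>k. of_real (fps_nth b k) * z ^ k"
  have "(\<lambda>m. \<Sum>i\<le>m. ?a i * ?b (m - i)) sums (suminf ?a * suminf ?b)"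
    by (intro Cauchy_product_sums disc_expansion_abs_summable[OF assms(1) z] disc_expansion_abs_summable[OF assms(2) z])
  also have "(\<lambda>m. \<Sum>i\<le>m. ?a i * ?b (m - i)) = (\<lambda>m. of_real (fps_nth (a * b) m) * z ^ m)"
  proof
    fix m
    have "?a i * ?b (m - i) = of_real (fps_nth a i * fps_nth b (m - i)) * z ^ m" if "i \<le> m" for i
      using that by (simp add: mult_ac power_add[symmetric])
    then show "(\<Sum>i\<le>m. ?a i * ?b (m - i)) = of_real (fps_nth (a * b) m) * z ^ m"
      by (simp add: fps_mult_nth atLeast0AtMost sum_distrib_right del: of_real_mult)
  qed
  finally show "(\<lambda>m. of_real (fps_nth (a * b) m) * z ^ m) sums (f z * g z)"
    using assms z by (simp add: disc_expansion_def sums_iff)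
qed

lemma disc_expansion_poly: "disc_expansion (cpoly p) (fps_nth (fps_of_poly p))"
  unfolding disc_expansion_def
proof (intro allI impI)
  fix z :: complex
  have "cpoly p z = (\<Sum>k\<le>degree p. of_real (coeff p k) * z ^ k)"
    by (simp add: poly_altdef coeff_map_poly degree_map_poly)
  moreover have "(\<lambda>k. of_real (coeff p k) * z ^ k) sums (\<Sum>k\<le>degree p. of_real (coeff p k) * z ^ k)"
    by (rule sums_finite) (auto simp: coeff_eq_0)
  ultimately show "(\<lambda>k. of_real (fps_nth (fps_of_poly p) k) * z ^ k) sums cpoly p z"
    by simp
qed

lemma disc_expansion_frac_diff:
  assumes s: "1 \<le> s"
  shows "disc_expansion (frac_diff s D) (fps_nth (seasonal_binomial s D))"
  unfolding disc_expansion_def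
proof (intro allI impI)
  fix z :: complex assume z: "norm z < 1"
  let ?f = "\<lambda>k. of_real (fps_nth (seasonal_binomial s D) k) * z ^ k"
  have "norm (- (z ^ s)) < 1"
    using z s by (simp add: norm_power power_less_one_iff)
  from gen_binomial_complex[OF this, of "of_real D"]
  have "(\<lambda>n. (of_real D gchoose n) * (- (z ^ s)) ^ n) sums frac_diff s D z"
    by (simp add: frac_diff_def)
  also have "(\<lambda>n. (of_real D gchoose n) * (- (z ^ s)) ^ n) = (\<lambda>n. ?f (s * n))"
  proof
    fix n
    have g: "(of_real D gchoose n :: complex) = of_real (D gchoose n)"
      by (simp add: gbinomial_prod_rev)
    have "(of_real D gchoose n) * (- (z ^ s)) ^ n = of_real ((-1) ^ n * (D gchoose n)) * z ^ (s * n)"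
      unfolding g by (simp add: power_minus[of "z ^ s"] power_mult)
    also have "(-1) ^ n * (D gchoose n) = fps_nth (seasonal_binomial s D) (s * n)"
      using s by (simp add: seasonal_binomial_nth gbinomial_pochhammer mult.assoc[symmetric] power_mult_distrib[symmetric])
    finally show "(of_real D gchoose n) * (- (z ^ s)) ^ n = ?f (s * n)" .
  qed
  finally show "?f sums frac_diff s D z"
    using sums_mono_reindex[OF seasonal_reindex(1)[OF s], of ?f] seasonal_reindex(2)[OF s]
    by (simp add: seasonal_binomial_nth)
qed

lemma disc_expansion_cong:
  "(\<And>z. norm z < 1 \<Longrightarrow> f z = g z) \<Longrightarrow> disc_expansion f c = disc_expansion g c"
  by (simp add: disc_expansion_def)

lemma disc_expansion_Abel_summable:
  assumes "disc_expansion f (fps_nth c)" "0 < r" "r < 1"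
  shows "abs_summable (weighted (\<lambda>k. r ^ k) c)"
  using disc_expansion_abs_summable[OF assms(1), of "of_real r"] assms(2,3)
  by (simp add: abs_summable_def norm_mult norm_power abs_mult mult.commute)

text \<open>
  With \<open>D = N \<eta>\<close> and \<open>0 < \<eta> < 1\<close>, the product is the \<open>N\<close>-th power of the one for \<open>\<eta>\<close>.  The factor
  \<open>r\<^sup>j\<close> comes from moving the dilation past a lag of order \<open>j\<close>, and tends to \<open>1\<close>.
\<close>

lemma seasonal_Abel_tendsto:
  assumes s: "1 \<le> s" and D: "0 < D"
  shows "energy_tendsto (\<lambda>r. weighted (\<lambda>k. r ^ (k + j)) (seasonal_binomial s (- D)) 
           * seasonal_binomial s D) 1 (at_left 1)"
proof -
  obtain N :: nat where N: "D < real N" using reals_Archimedean2 by blast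
  define \<eta> where "\<eta> = D / real N"
  have \<eta>: "0 < \<eta>" "\<eta> < 1" "D = real N * \<eta>" "- D = real N * (- \<eta>)"
    using N D by (auto simp: \<eta>_def field_simps)
  interpret antipersistent_pair "seasonal_binomial s (- \<eta>)" "seasonal_binomial s \<eta>"
    by (rule antipersistent_seasonal_binomial[OF s \<eta>(1,2)])
  have "energy_tendsto (\<lambda>r. fps_const (r ^ j) * 
      (weighted (\<lambda>k. r ^ k) (seasonal_binomial s (- \<eta>)) * seasonal_binomial s \<eta>) ^ N) 1 (at_left 1)"
  proof (rule energy_tendsto_scale)
    show "energy_tendsto (\<lambda>r. (weighted (\<lambda>k. r ^ k) (seasonal_binomial s (- \<eta>)) * 
        seasonal_binomial s \<eta>) ^ N) 1 (at_left 1)"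
      by (rule Abel_power_tendsto, rule disc_expansion_Abel_summable[OF disc_expansion_frac_diff[OF s]])
    show "((\<lambda>r. r ^ j) \<longlongrightarrow> 1) (at_left (1::real))" by (auto intro!: tendsto_eq_intros)
    show "sq_summable 1" by (rule sq_summable_finite_support[of 1]) auto
  qed
  moreover have "fps_const (r ^ j) * 
      (weighted (\<lambda>k. r ^ k) (seasonal_binomial s (- \<eta>)) * seasonal_binomial s \<eta>) ^ N
    = weighted (\<lambda>k. r ^ (k + j)) (seasonal_binomial s (- D)) * seasonal_binomial s D" for r
  proof -
    have "weighted (\<lambda>k. r ^ (k + j)) f = fps_const (r ^ j) * weighted (\<lambda>k. r ^ k) f" for f
      by (simp add: fps_eq_iff power_add mult_ac)
    moreover have "seasonal_binomial s D = seasonal_binomial s \<eta> ^ N"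
      unfolding \<eta>(3) by (rule seasonal_binomial_power[OF s])
    moreover have "seasonal_binomial s (- D) = seasonal_binomial s (- \<eta>) ^ N"
      unfolding \<eta>(4) by (rule seasonal_binomial_power[OF s])
    ultimately show ?thesis
      by (simp only: weighted_geometric_power power_mult_distrib mult.assoc)
  qed
  ultimately show ?thesis by simp
qed

section \<open>The rational factor\<close>

text \<open>
  The finitely many zeros of \<open>p\<close> stay outside a disc of some radius \<open>r > 1\<close>, where \<open>1/p\<close> is
  holomorphic; so its expansion converges absolutely at \<open>z = 1\<close>.
\<close>

lemma inverse_poly_abs_summable:
  fixes p :: "real poly"
  assumes p0: "coeff p 0 = 1" and nz: "\<And>z. norm z \<le> 1 \<Longrightarrow> cpoly p z \<noteq> 0"
  shows "abs_summable (inverse (fps_of_poly p))"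
proof -
  let ?P = "map_poly complex_of_real p"
  let ?i = "inverse (fps_of_poly p)"
  have "?P \<noteq> 0" using nz[of 0] by auto
  then have fin: "finite {z. cpoly p z = 0}" by (rule poly_roots_finite)
  obtain r where r: "1 < r" "\<And>z. norm z < r \<Longrightarrow> cpoly p z \<noteq> 0"
  proof
    let ?R = "insert 2 (norm ` {z. cpoly p z = 0})"
    show "1 < Min ?R" using fin nz by (subst Min_gr_iff) (auto simp: not_le[symmetric])
    show "cpoly p z \<noteq> 0" if "norm z < Min ?R" for z using that fin by (auto simp: Min_gr_iff)
  qed
  have "min (ereal r) (fps_conv_radius (fps_of_poly ?P)) \<le> fps_conv_radius (inverse (fps_of_poly ?P))"
    by (rule fps_conv_radius_inverse) (use r in auto)
  then have "ereal r \<le> fps_conv_radius (inverse (fps_of_poly ?P))" by simp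
  then have "ereal (norm (1::complex)) < fps_conv_radius (inverse (fps_of_poly ?P))"
    using r(1) by (auto intro: less_le_trans[of _ "ereal r"])
  from norm_summable_fps[OF this]
  have sum: "summable (\<lambda>k. norm (fps_nth (inverse (fps_of_poly ?P)) k))" by simp
  have "fps_of_poly p * ?i = 1" using p0 by (intro inverse_mult_eq_1') auto
  then have real: "(\<Sum>k\<le>m. coeff p k * fps_nth ?i (m - k)) = (if m = 0 then 1 else 0)" for m
    by (auto simp: fps_eq_iff fps_mult_nth atLeast0AtMost)
  have "fps_of_poly ?P * Abs_fps (\<lambda>k. complex_of_real (fps_nth ?i k)) = 1"
    using real[THEN arg_cong[of _ _ complex_of_real]]
    by (auto simp: fps_eq_iff fps_mult_nth atLeast0AtMost coeff_map_poly)
  then have "inverse (fps_of_poly ?P) = Abs_fps (\<lambda>k. complex_of_real (fps_nth ?i k))"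
    by (rule fps_inverse_unique)
  then show ?thesis using sum by (simp add: abs_summable_def)
qed

lemma fps_of_poly_as_sum: "fps_of_poly p = (\<Sum>j\<le>degree p. fps_const (coeff p j) * fps_X ^ j)"
proof -
  have "fps_nth (\<Sum>j\<le>degree p. fps_const (coeff p j) * fps_X ^ j) n = coeff p n" for n
    by (simp add: fps_sum_nth coeff_eq_0 if_distrib[of "\<lambda>x. _ * x"] cong: if_cong)
  then show ?thesis by (simp add: fps_eq_iff)
qed

text \<open>
  Expanding \<open>q = \<Sum> q\<^sub>j z\<^sup>j\<close> moves the weights onto \<open>c\<close>, shifted by \<open>j\<close>.  Each term converges to
  \<open>q\<^sub>j z\<^sup>j \<rho>\<close> by Young's inequality, and these add up to \<open>q \<rho> = p\<close>.
\<close>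

lemma weighted_poly_product_tendsto:
  fixes p q :: "real poly" and w :: "'i \<Rightarrow> nat \<Rightarrow> real"
  assumes \<rho>: "abs_summable \<rho>" "fps_of_poly q * \<rho> = fps_of_poly p"
    and lim: "\<And>j. energy_tendsto (\<lambda>i. weighted (\<lambda>k. w i (k + j)) c * l) 1 F"
  shows "energy_tendsto (\<lambda>i. weighted (w i) (fps_of_poly q * c) * (\<rho> * l)) (fps_of_poly p) F"
proof -
  let ?g = "\<lambda>j. fps_const (coeff q j) * fps_X ^ j * \<rho>"
  have "abs_summable (fps_const (coeff q j) * fps_X ^ j)" for j
    by (rule abs_summable_finite_support[of "Suc j"]) auto
  then have "abs_summable (?g j)" for j by (rule abs_summable_mult[OF _ \<rho>(1)])
  then have "energy_tendsto (\<lambda>i. \<Sum>j\<le>degree q. ?g j * (weighted (\<lambda>k. w i (k + j)) c * l)) 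
      (\<Sum>j\<le>degree q. ?g j * 1) F"
    by (intro energy_tendsto_sum energy_tendsto_mult_left lim) auto
  moreover have "(\<Sum>j\<le>degree q. ?g j * 1) = fps_of_poly p"
    unfolding \<rho>(2)[symmetric] fps_of_poly_as_sum[of q] by (simp add: sum_distrib_right)
  moreover have "weighted (w i) (fps_of_poly q * c) * (\<rho> * l) = 
      (\<Sum>j\<le>degree q. ?g j * (weighted (\<lambda>k. w i (k + j)) c * l))" for i
  proof -
    have "weighted (w i) (fps_of_poly q * c) = 
        (\<Sum>j\<le>degree q. fps_const (coeff q j) * (fps_X ^ j * weighted (\<lambda>k. w i (k + j)) c))"
      unfolding fps_of_poly_as_sum[of q] sum_distrib_right mult.assoc weighted_sum weighted_lag ..
    then show ?thesis by (simp add: sum_distrib_left sum_distrib_right mult_ac)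
  qed
  ultimately show ?thesis by simp
qed

section \<open>Mean-square convergence\<close>

lemma integrable_product:
  assumes "square_integrable M X" "square_integrable M Y"
  shows "integrable M (\<lambda>x. X x * Y x)"
proof (rule Bochner_Integration.integrable_bound)
  show "integrable M (\<lambda>x. (X x)\<^sup>2 + (Y x)\<^sup>2)" using assms by (simp add: square_integrable_def)
  show "(\<lambda>x. X x * Y x) \<in> borel_measurable M" using assms by (auto simp: square_integrable_def)
  have "\<bar>a * b\<bar> \<le> a\<^sup>2 + b\<^sup>2" for a b :: real
  proof -
    have "0 \<le> \<bar>a * b\<bar>" "2 * \<bar>a * b\<bar> \<le> a\<^sup>2 + b\<^sup>2"
      using sum_squares_bound[of "\<bar>a\<bar>" "\<bar>b\<bar>"] by (auto simp: abs_mult mult.assoc)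
    then show ?thesis by linarith
  qed
  then show "AE x in M. norm (X x * Y x) \<le> norm ((X x)\<^sup>2 + (Y x)\<^sup>2)" by simp
qed

lemma square_integrable_add:
  assumes "square_integrable M X" "square_integrable M Y"
  shows "square_integrable M (\<lambda>x. X x + Y x)"
  using assms integrable_product[OF assms]
  by (auto simp: square_integrable_def power2_sum mult.assoc)

lemma square_integrable_cmult:
  assumes "square_integrable M X"
  shows "square_integrable M (\<lambda>x. a * X x)"
  using assms by (auto simp: square_integrable_def power_mult_distrib)

lemma square_integrable_diff:
  assumes "square_integrable M X" "square_integrable M Y"
  shows "square_integrable M (\<lambda>x. X x - Y x)"
  using square_integrable_add[OF assms(1) square_integrable_cmult[OF assms(2), of "-1"]] by simp

lemma square_integrable_zero [simp]: "square_integrable M (\<lambda>x. 0)"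
  by (simp add: square_integrable_def)

lemma square_integrable_sum:
  assumes "\<And>k. k \<in> A \<Longrightarrow> square_integrable M (X k)"
  shows "square_integrable M (\<lambda>x. \<Sum>k\<in>A. X k x)"
proof (cases "finite A")
  case True
  then show ?thesis using assms
    by (induction A rule: finite_induct) (auto intro: square_integrable_add)
qed simp

lemma integral_square_add_le:
  assumes "square_integrable M X" "square_integrable M Y"
  shows "(\<integral>x. (X x + Y x)\<^sup>2 \<partial>M) \<le> 2 * (\<integral>x. (X x)\<^sup>2 \<partial>M) + 2 * (\<integral>x. (Y x)\<^sup>2 \<partial>M)"
proof -
  have "(\<integral>x. (X x + Y x)\<^sup>2 \<partial>M) \<le> (\<integral>x. 2 * (X x)\<^sup>2 + 2 * (Y x)\<^sup>2 \<partial>M)"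
  proof (rule integral_mono)
    show "integrable M (\<lambda>x. (X x + Y x)\<^sup>2)" 
      using square_integrable_add[OF assms] by (simp add: square_integrable_def)
    show "integrable M (\<lambda>x. 2 * (X x)\<^sup>2 + 2 * (Y x)\<^sup>2)" 
      using assms by (simp add: square_integrable_def)
    show "(X x + Y x)\<^sup>2 \<le> 2 * (X x)\<^sup>2 + 2 * (Y x)\<^sup>2" for x
      using sum_squares_bound[of "X x" "Y x"] by (simp add: power2_sum)
  qed
  then show ?thesis using assms by (simp add: square_integrable_def)
qed

text \<open>
  The quadratic polynomial \<open>t \<mapsto> \<integral>(X - t Y)\<^sup>2\<close> is nonnegative; evaluate it at its minimum, or, if it
  is affine, at a point where it would be negative.
\<close>

lemma integral_Cauchy_Schwarz:
  assumes "square_integrable M X" "square_integrable M Y"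
  shows "(\<integral>x. X x * Y x \<partial>M)\<^sup>2 \<le> (\<integral>x. (X x)\<^sup>2 \<partial>M) * (\<integral>x. (Y x)\<^sup>2 \<partial>M)"
proof -
  let ?A = "\<integral>x. (X x)\<^sup>2 \<partial>M" and ?B = "\<integral>x. X x * Y x \<partial>M" and ?C = "\<integral>x. (Y x)\<^sup>2 \<partial>M"
  have quad: "0 \<le> ?A - 2 * t * ?B + t\<^sup>2 * ?C" for t
  proof -
    have "0 \<le> (\<integral>x. (X x - t * Y x)\<^sup>2 \<partial>M)" by simp
    also have "\<dots> = (\<integral>x. (X x)\<^sup>2 - 2 * t * (X x * Y x) + t\<^sup>2 * (Y x)\<^sup>2 \<partial>M)"
      by (intro Bochner_Integration.integral_cong) (auto simp: power2_eq_square algebra_simps)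
    also have "\<dots> = ?A - 2 * t * ?B + t\<^sup>2 * ?C"
      using assms integrable_product[OF assms] by (simp add: square_integrable_def)
    finally show ?thesis .
  qed
  show ?thesis
  proof (cases "?C = 0")
    case True
    have "?B = 0"
    proof (rule ccontr)
      assume "?B \<noteq> 0"
      then show False using quad[of "(?A + 1) / (2 * ?B)"] True by (simp add: field_simps)
    qed
    then show ?thesis using True by simp
  next
    case False
    then have "0 < ?C" by (simp add: order_less_le)
    then show ?thesis using quad[of "?B / ?C"]
      by (simp add: field_simps power2_eq_square)
  qed
qed

lemma L2_tendsto_add:
  assumes X: "L2_tendsto M X V F" and Y: "L2_tendsto M Y W F"
  shows "L2_tendsto M (\<lambda>i x. X i x + Y i x) (\<lambda>x. V x + W x) F"
  unfolding L2_tendsto_def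
proof (intro conjI)
  have V: "square_integrable M V" "square_integrable M W" using X Y by (auto simp: L2_tendsto_def)
  show "square_integrable M (\<lambda>x. V x + W x)" by (intro square_integrable_add V)
  have ev: "\<forall>\<^sub>F i in F. square_integrable M (X i) \<and> square_integrable M (Y i)"
    using X Y by (auto simp: L2_tendsto_def intro: eventually_conj)
  then show "\<forall>\<^sub>F i in F. square_integrable M (\<lambda>x. X i x + Y i x)"
    by eventually_elim (auto intro: square_integrable_add)
  have lim: "((\<lambda>i. 2 * (\<integral>x. (X i x - V x)\<^sup>2 \<partial>M) + 2 * (\<integral>x. (Y i x - W x)\<^sup>2 \<partial>M)) \<longlongrightarrow> 0) F"
    using X Y by (auto simp: L2_tendsto_def intro!: tendsto_eq_intros)
  show "((\<lambda>i. \<integral>x. (X i x + Y i x - (V x + W x))\<^sup>2 \<partial>M) \<longlongrightarrow> 0) F"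
  proof (rule tendsto_sandwich[OF _ _ tendsto_const lim])
    show "\<forall>\<^sub>F i in F. 0 \<le> (\<integral>x. (X i x + Y i x - (V x + W x))\<^sup>2 \<partial>M)" by simp
    show "\<forall>\<^sub>F i in F. (\<integral>x. (X i x + Y i x - (V x + W x))\<^sup>2 \<partial>M)
       \<le> 2 * (\<integral>x. (X i x - V x)\<^sup>2 \<partial>M) + 2 * (\<integral>x. (Y i x - W x)\<^sup>2 \<partial>M)"
      using ev
    proof eventually_elim
      case (elim i)
      have e: "X i x + Y i x - (V x + W x) = (X i x - V x) + (Y i x - W x)" for x by simp
      show ?case unfolding e 
        using elim V by (intro integral_square_add_le square_integrable_diff) auto
    qed
  qed
qed

lemma L2_tendsto_cmult:
  assumes "L2_tendsto M X V F"
  shows "L2_tendsto M (\<lambda>i x. a * X i x) (\<lambda>x. a * V x) F"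
proof -
  have "(\<lambda>i. \<integral>x. (a * X i x - a * V x)\<^sup>2 \<partial>M) = (\<lambda>i. a\<^sup>2 * (\<integral>x. (X i x - V x)\<^sup>2 \<partial>M))"
    by (simp add: right_diff_distrib[symmetric] power_mult_distrib)
  moreover have "\<forall>\<^sub>F i in F. square_integrable M (\<lambda>x. a * X i x)"
    using assms[unfolded L2_tendsto_def, THEN conjunct1]
    by eventually_elim (rule square_integrable_cmult)
  ultimately show ?thesis using assms
    by (simp add: L2_tendsto_def square_integrable_cmult tendsto_mult_right_zero)
qed

lemma L2_tendsto_square_integral:
  assumes X: "L2_tendsto M X V F"
  shows "((\<lambda>i. \<integral>x. (X i x)\<^sup>2 \<partial>M) \<longlongrightarrow> (\<integral>x. (V x)\<^sup>2 \<partial>M)) F"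
proof -
  let ?d = "\<lambda>i. \<integral>x. (X i x - V x)\<^sup>2 \<partial>M" and ?v = "\<integral>x. (V x)\<^sup>2 \<partial>M"
  have V: "square_integrable M V" and d: "(?d \<longlongrightarrow> 0) F" using X by (auto simp: L2_tendsto_def)
  have lim: "((\<lambda>i. ?d i + 2 * sqrt (?d i * ?v)) \<longlongrightarrow> 0) F"
    using d by (auto intro!: tendsto_eq_intros)
  have "\<forall>\<^sub>F i in F. norm ((\<integral>x. (X i x)\<^sup>2 \<partial>M) - ?v) \<le> ?d i + 2 * sqrt (?d i * ?v)"
    using X[unfolded L2_tendsto_def, THEN conjunct1]
  proof eventually_elim
    case (elim i)
    let ?D = "\<lambda>x. X i x - V x"
    have D: "square_integrable M ?D" by (intro square_integrable_diff elim V)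
    have "(\<integral>x. (X i x)\<^sup>2 \<partial>M) = (\<integral>x. (?D x)\<^sup>2 + 2 * (?D x * V x) + (V x)\<^sup>2 \<partial>M)"
      by (intro Bochner_Integration.integral_cong) (auto simp: power2_eq_square algebra_simps)
    also have "\<dots> = ?d i + 2 * (\<integral>x. ?D x * V x \<partial>M) + ?v"
    proof -
      have "integrable M (\<lambda>x. (?D x)\<^sup>2)" "integrable M (\<lambda>x. (V x)\<^sup>2)" "integrable M (\<lambda>x. ?D x * V x)"
        using D V integrable_product[OF D V] by (auto simp only: square_integrable_def)
      then show ?thesis by simp
    qed
    finally have e: "(\<integral>x. (X i x)\<^sup>2 \<partial>M) - ?v = ?d i + 2 * (\<integral>x. ?D x * V x \<partial>M)" by simp
    have "\<bar>\<integral>x. ?D x * V x \<partial>M\<bar> \<le> sqrt (?d i * ?v)"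
      using integral_Cauchy_Schwarz[OF D V] by (intro real_le_rsqrt) simp
    moreover have "0 \<le> ?d i" by simp
    ultimately show ?case unfolding e real_norm_def by linarith
  qed
  then have "((\<lambda>i. (\<integral>x. (X i x)\<^sup>2 \<partial>M) - ?v) \<longlongrightarrow> 0) F"
    by (rule Lim_null_comparison[OF _ lim])
  then show ?thesis by (simp add: LIM_zero_iff)
qed

lemma shift_series_square_integrable:
  "shift_series M c X t V \<Longrightarrow> square_integrable M V"
  by (simp add: shift_series_def L2_sums_def L2_tendsto_def)

lemma shift_series_add:
  assumes "shift_series M (fps_nth f) X t V" "shift_series M (fps_nth g) X t W"
  shows "shift_series M (fps_nth (f + g)) X t (\<lambda>x. V x + W x)"
  using L2_tendsto_add[OF assms[unfolded shift_series_def L2_sums_def]]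
  by (simp add: shift_series_def L2_sums_def distrib_right sum.distrib)

lemma shift_series_cmult:
  assumes "shift_series M (fps_nth f) X t V"
  shows "shift_series M (fps_nth (fps_const a * f)) X t (\<lambda>x. a * V x)"
  using L2_tendsto_cmult[OF assms[unfolded shift_series_def L2_sums_def], of a]
  by (simp add: shift_series_def L2_sums_def sum_distrib_left mult.assoc)

lemma shift_series_diff:
  assumes "shift_series M (fps_nth f) X t V" "shift_series M (fps_nth g) X t W"
  shows "shift_series M (fps_nth (f - g)) X t (\<lambda>x. V x - W x)"
proof -
  have e: "f - g = f + fps_const (-1) * g" by (simp add: fps_eq_iff)
  show ?thesis
    unfolding e using shift_series_add[OF assms(1) shift_series_cmult[OF assms(2), of "-1"]] by simp
qed

lemma shift_series_lag:
  assumes "shift_series M (fps_nth f) X (t - int k) V"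
  shows "shift_series M (fps_nth (fps_X ^ k * f)) X t V"
proof -
  let ?S = "\<lambda>n x. \<Sum>m<n. fps_nth (fps_X ^ k * f) m * X (t - int m) x"
  have "?S (n + k) x = (\<Sum>m<n. fps_nth f m * X (t - int k - int m) x)" for n x
  proof (induction n)
    case 0
    show ?case by (auto simp: fps_X_power_mult_nth intro!: sum.neutral)
  next
    case (Suc n)
    have "X (t - int (n + k)) x = X (t - int k - int n) x"
      by (rule arg_cong[of _ _ "\<lambda>u. X u x"]) simp
    then show ?case using Suc.IH by (simp add: fps_X_power_mult_nth del: of_nat_add)
  qed
  then have *: "L2_tendsto M (\<lambda>n. ?S (n + k)) V sequentially"
    using assms by (simp add: shift_series_def L2_sums_def)
  have "L2_tendsto M ?S V sequentially"
    unfolding L2_tendsto_def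
  proof (intro conjI)
    show "\<forall>\<^sub>F n in sequentially. square_integrable M (?S n)"
      using *[unfolded L2_tendsto_def, THEN conjunct1]
      by (rule eventually_sequentially_seg[THEN iffD1])
    show "square_integrable M V" using * by (simp add: L2_tendsto_def)
    show "(\<lambda>n. \<integral>x. (?S n x - V x)\<^sup>2 \<partial>M) \<longlonglongrightarrow> 0"
      using *[unfolded L2_tendsto_def, THEN conjunct2, THEN conjunct2] by (rule LIMSEQ_offset)
  qed
  then show ?thesis by (simp add: shift_series_def L2_sums_def)
qed

lemma shift_series_finite:
  assumes "\<And>t. square_integrable M (X t)" "\<And>k. k > n \<Longrightarrow> fps_nth f k = 0"
  shows "shift_series M (fps_nth f) X t (\<lambda>x. \<Sum>k\<le>n. fps_nth f k * X (t - int k) x)"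
  unfolding shift_series_def L2_sums_def L2_tendsto_def
proof (intro conjI)
  let ?S = "\<lambda>m x. \<Sum>k<m. fps_nth f k * X (t - int k) x"
  let ?V = "\<lambda>x. \<Sum>k\<le>n. fps_nth f k * X (t - int k) x"
  show "\<forall>\<^sub>F m in sequentially. square_integrable M (?S m)"
    by (intro always_eventually allI square_integrable_sum square_integrable_cmult assms)
  show "square_integrable M ?V"
    by (intro square_integrable_sum square_integrable_cmult assms)
  have "?S m x = ?V x" if "m > n" for m x
    by (rule sum.mono_neutral_right) (use that assms in auto)
  then have "\<forall>\<^sub>F m in sequentially. (\<integral>x. (?S m x - ?V x)\<^sup>2 \<partial>M) = 0"
    by (intro eventually_mono[OF eventually_gt_at_top[of n]]) simp
  then show "(\<lambda>m. \<integral>x. (?S m x - ?V x)\<^sup>2 \<partial>M) \<longlonglongrightarrow> 0" by (rule tendsto_eventually)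
qed

lemma shift_series_truncated_mult:
  assumes "\<And>u. shift_series M (fps_nth f) X u (Y u)"
  shows "shift_series M (fps_nth (truncated n c * f)) X t
           (\<lambda>x. \<Sum>k<n. fps_nth c k * Y (t - int k) x)"
proof (induction n)
  case 0
  have "truncated 0 c = 0" by (simp add: fps_eq_iff)
  then show ?case using shift_series_cmult[OF assms[of t], of 0] by (simp add: fps_zero_def)
next
  case (Suc n)
  have e: "truncated (Suc n) c * f = truncated n c * f + fps_const (fps_nth c n) * (fps_X ^ n * f)"
    by (simp add: truncated_Suc distrib_right mult.assoc)
  show ?case
    unfolding e sum.lessThan_Suc
    by (intro shift_series_add Suc.IH shift_series_cmult shift_series_lag assms)
qed

text \<open>
  Cauchy--Schwarz with \<open>\<bar>a\<^sub>k y\<^sub>k\<bar> = \<surd>\<bar>a\<^sub>k\<bar> \<cdot> \<surd>\<bar>a\<^sub>k\<bar> \<bar>y\<^sub>k\<bar>\<close>.  The second factor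
  of the bound is independent of \<open>n\<close>, which makes it an integrable majorant below.
\<close>

lemma weighted_square_tail_bound:
  fixes a y :: "nat \<Rightarrow> real"
  assumes a: "summable (\<lambda>k. \<bar>a k\<bar>)" and y: "summable (\<lambda>k. \<bar>a k\<bar> * (y k)\<^sup>2)"
  shows "((\<Sum>k<n. a k * y k) - (\<Sum>k. a k * y k))\<^sup>2
           \<le> (\<Sum>k. \<bar>a (k + n)\<bar>) * (\<Sum>k. \<bar>a k\<bar> * (y k)\<^sup>2)"
proof -
  have "\<bar>a k * y k\<bar> \<le> \<bar>a k\<bar> + \<bar>a k\<bar> * (y k)\<^sup>2" for k
  proof -
    have "\<bar>y k\<bar> \<le> 1 + (y k)\<^sup>2" using sum_squares_bound[of "\<bar>y k\<bar>" 1] by simp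
    from mult_left_mono[OF this, of "\<bar>a k\<bar>"] show ?thesis by (simp add: abs_mult distrib_left)
  qed
  then have s: "summable (\<lambda>k. a k * y k)"
    by (intro summable_comparison_test'[OF summable_add[OF a y], of 0]) auto
  have tail: "(\<Sum>k. a k * y k) - (\<Sum>k<n. a k * y k) = (\<Sum>k. a (k + n) * y (k + n))"
    using suminf_minus_initial_segment[OF s, of n] by simp
  have an: "summable (\<lambda>k. \<bar>a (k + n)\<bar>)" using a by (rule summable_ignore_initial_segment)
  have yn: "summable (\<lambda>k. \<bar>a (k + n)\<bar> * (y (k + n))\<^sup>2)" 
    using summable_ignore_initial_segment[OF y] by simp
  have fin: "(\<Sum>k<m. a (k + n) * y (k + n))\<^sup>2 
      \<le> (\<Sum>k. \<bar>a (k + n)\<bar>) * (\<Sum>k. \<bar>a k\<bar> * (y k)\<^sup>2)" for m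
  proof -
    have "\<bar>\<Sum>k<m. a (k + n) * y (k + n)\<bar> \<le> (\<Sum>k<m. \<bar>a (k + n)\<bar> * \<bar>y (k + n)\<bar>)"
      unfolding abs_mult[symmetric] by (rule sum_abs)
    also have "\<dots> = (\<Sum>k<m. sqrt \<bar>a (k + n)\<bar> * (sqrt \<bar>a (k + n)\<bar> * \<bar>y (k + n)\<bar>))"
      by (simp add: mult.assoc[symmetric])
    finally have "(\<Sum>k<m. a (k + n) * y (k + n))\<^sup>2 
        \<le> (\<Sum>k<m. sqrt \<bar>a (k + n)\<bar> * (sqrt \<bar>a (k + n)\<bar> * \<bar>y (k + n)\<bar>))\<^sup>2"
      by (rule power2_le_iff_abs_le[THEN iffD2, rotated]) (auto intro!: sum_nonneg)
    also have "\<dots> \<le> (\<Sum>k<m. (sqrt \<bar>a (k + n)\<bar>)\<^sup>2) * (\<Sum>k<m. (sqrt \<bar>a (k + n)\<bar> * \<bar>y (k + n)\<bar>)\<^sup>2)"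
      by (rule Cauchy_Schwarz_ineq_sum)
    also have "\<dots> = (\<Sum>k<m. \<bar>a (k + n)\<bar>) * (\<Sum>k<m. \<bar>a (k + n)\<bar> * (y (k + n))\<^sup>2)"
      by (simp add: power_mult_distrib)
    also have "\<dots> \<le> (\<Sum>k. \<bar>a (k + n)\<bar>) * (\<Sum>k. \<bar>a (k + n)\<bar> * (y (k + n))\<^sup>2)"
      using an yn by (intro mult_mono sum_le_suminf suminf_nonneg sum_nonneg) auto
    also have "\<dots> \<le> (\<Sum>k. \<bar>a (k + n)\<bar>) * (\<Sum>k. \<bar>a k\<bar> * (y k)\<^sup>2)"
      using suminf_minus_initial_segment[OF y, of n] an
      by (intro mult_left_mono suminf_nonneg) (auto intro!: sum_nonneg)
    finally show ?thesis .
  qed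
  have "(\<lambda>m. (\<Sum>k<m. a (k + n) * y (k + n))\<^sup>2) \<longlonglongrightarrow> (\<Sum>k. a (k + n) * y (k + n))\<^sup>2"
    using summable_ignore_initial_segment[OF s, of n]
    by (intro tendsto_intros summable_LIMSEQ) auto
  then have "(\<Sum>k. a (k + n) * y (k + n))\<^sup>2 \<le> (\<Sum>k. \<bar>a (k + n)\<bar>) * (\<Sum>k. \<bar>a k\<bar> * (y k)\<^sup>2)"
    by (rule LIMSEQ_le_const2) (use fin in auto)
  then show ?thesis unfolding tail[symmetric] by (simp add: power2_commute)
qed

text \<open>
  A case of the completeness of \<open>L\<^sup>2\<close> in which the limit can be taken pointwise: the series
  \<open>\<Sum> \<bar>a\<^sub>k\<bar> X\<^sub>k\<^sup>2\<close> has a finite integral, hence converges almost everywhere, and together with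
  \<open>weighted_square_tail_bound\<close> it dominates the squared remainders.
\<close>

lemma L2_sums_absolutely_convergent:
  assumes X: "\<And>k. square_integrable M (X k)" and K: "\<And>k. (\<integral>x. (X k x)\<^sup>2 \<partial>M) \<le> K"
    and a: "summable (\<lambda>k. \<bar>a k\<bar>)"
  shows "\<exists>W. L2_sums M (\<lambda>k x. a k * X k x) W"
proof -
  let ?g = "\<lambda>k x. \<bar>a k\<bar> * (X k x)\<^sup>2"
  let ?G = "\<lambda>x. \<Sum>k. ?g k x" and ?W = "\<lambda>x. \<Sum>k. a k * X k x"
  let ?S = "\<lambda>n x. \<Sum>k<n. a k * X k x" and ?t = "\<lambda>n. \<Sum>k. \<bar>a (k + n)\<bar>"
  have [measurable]: "X k \<in> borel_measurable M" for k using X by (simp add: square_integrable_def)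
  have gi: "integrable M (?g k)" for k using X by (simp add: square_integrable_def)
  have gs: "summable (\<lambda>k. \<integral>x. ?g k x \<partial>M)"
    by (rule summable_comparison_test'[OF summable_mult2[OF a, of K], of 0])
       (use K in \<open>simp add: mult_left_mono\<close>)
  have ae: "AE x in M. summable (\<lambda>k. ?g k x)"
  proof -
    have "(\<integral>\<^sup>+x. (\<Sum>k. ennreal (?g k x)) \<partial>M) = (\<Sum>k. \<integral>\<^sup>+x. ennreal (?g k x) \<partial>M)"
      by (rule nn_integral_suminf) simp
    also have "\<dots> = (\<Sum>k. ennreal (\<integral>x. ?g k x \<partial>M))"
      by (intro suminf_cong nn_integral_eq_integral gi) auto
    also have "\<dots> \<noteq> \<infinity>"
      by (subst suminf_ennreal2[OF _ gs]) auto
    finally have "AE x in M. (\<Sum>k. ennreal (?g k x)) \<noteq> \<infinity>"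
      by (intro nn_integral_noteq_infinite) auto
    then show ?thesis
      by eventually_elim (auto intro: summable_suminf_not_top)
  qed
  have G: "integrable M ?G"
    by (rule integrable_suminf[OF gi]) (use ae gs in auto)
  have bound: "AE x in M. (?S n x - ?W x)\<^sup>2 \<le> ?t n * ?G x" for n
    using ae by eventually_elim (rule weighted_square_tail_bound[OF a])
  have "integrable M (\<lambda>x. (?W x)\<^sup>2)"
  proof (rule Bochner_Integration.integrable_bound)
    show "integrable M (\<lambda>x. ?t 0 * ?G x)" using G by simp
    show "AE x in M. norm ((?W x)\<^sup>2) \<le> norm (?t 0 * ?G x)"
      using bound[of 0] by eventually_elim simp
  qed measurable
  then have W: "square_integrable M ?W" by (simp add: square_integrable_def)
  have S: "square_integrable M (?S n)" for n
    by (intro square_integrable_sum square_integrable_cmult X)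
  have t: "?t \<longlonglongrightarrow> 0"
  proof -
    have "(\<lambda>n. (\<Sum>k. \<bar>a k\<bar>) - (\<Sum>k<n. \<bar>a k\<bar>)) \<longlonglongrightarrow> (\<Sum>k. \<bar>a k\<bar>) - (\<Sum>k. \<bar>a k\<bar>)"
      by (rule tendsto_diff[OF tendsto_const summable_LIMSEQ[OF a]])
    then show ?thesis by (simp add: suminf_minus_initial_segment[OF a])
  qed
  have "(\<lambda>n. \<integral>x. (?S n x - ?W x)\<^sup>2 \<partial>M) \<longlonglongrightarrow> 0"
  proof (rule tendsto_sandwich[OF _ _ tendsto_const])
    show "(\<lambda>n. ?t n * (\<integral>x. ?G x \<partial>M)) \<longlonglongrightarrow> 0" using tendsto_mult_left_zero[OF t] by simp
    show "\<forall>\<^sub>F n in sequentially. 0 \<le> (\<integral>x. (?S n x - ?W x)\<^sup>2 \<partial>M)" by simp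
    have "(\<integral>x. (?S n x - ?W x)\<^sup>2 \<partial>M) \<le> ?t n * (\<integral>x. ?G x \<partial>M)" for n
    proof -
      have "(\<integral>x. (?S n x - ?W x)\<^sup>2 \<partial>M) \<le> (\<integral>x. ?t n * ?G x \<partial>M)"
        using square_integrable_diff[OF S W, of n] G bound[of n]
        by (intro integral_mono_AE) (auto simp: square_integrable_def)
      then show ?thesis by simp
    qed
    then show "\<forall>\<^sub>F n in sequentially. (\<integral>x. (?S n x - ?W x)\<^sup>2 \<partial>M) \<le> ?t n * (\<integral>x. ?G x \<partial>M)"
      by simp
  qed
  then show ?thesis using S W unfolding L2_sums_def L2_tendsto_def
    by (intro exI[of _ ?W]) auto
qed

section \<open>Linear filters of white noise\<close>

text \<open>
  The case \<open>v = 0\<close> is included.  All filters of the noise are then null, and nothing can be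
  inferred about their coefficients; hence the case distinctions on \<open>v\<close>.
\<close>

locale white_noise_filter =
  fixes M :: "'a measure" and eps :: "int \<Rightarrow> 'a \<Rightarrow> real" and v :: real
  assumes sq_int: "square_integrable M (eps t)"
    and variance: "(\<integral>x. (eps t x)\<^sup>2 \<partial>M) = v"
    and orthogonal: "t \<noteq> u \<Longrightarrow> (\<integral>x. eps t x * eps u x \<partial>M) = 0"
begin

lemma v_nonneg: "0 \<le> v"
  using variance[of 0] by (metis integral_nonneg_AE AE_I2 zero_le_power2)

lemma finite_isometry:
  "(\<integral>x. (\<Sum>k<n. y k * eps (t - int k) x)\<^sup>2 \<partial>M) = (\<Sum>k<n. v * (y k)\<^sup>2)"
proof (induction n)
  case (Suc n)
  let ?S = "\<lambda>x. \<Sum>k<n. y k * eps (t - int k) x" and ?e = "eps (t - int n)"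
  have S: "square_integrable M ?S" by (intro square_integrable_sum square_integrable_cmult sq_int)
  have "(\<integral>x. ?S x * ?e x \<partial>M) = (\<integral>x. (\<Sum>k<n. y k * (eps (t - int k) x * ?e x)) \<partial>M)"
    by (simp add: sum_distrib_right mult.assoc)
  also have "\<dots> = (\<Sum>k<n. y k * (\<integral>x. eps (t - int k) x * ?e x \<partial>M))"
    by (subst Bochner_Integration.integral_sum) (auto intro!: integrable_product sq_int)
  also have "\<dots> = 0" by (intro sum.neutral) (auto simp: orthogonal)
  finally have cross: "(\<integral>x. ?S x * ?e x \<partial>M) = 0" .
  have "(\<integral>x. (\<Sum>k<Suc n. y k * eps (t - int k) x)\<^sup>2 \<partial>M) =
      (\<integral>x. (?S x)\<^sup>2 + 2 * y n * (?S x * ?e x) + (y n)\<^sup>2 * (?e x)\<^sup>2 \<partial>M)"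
    by (intro Bochner_Integration.integral_cong) (auto simp: power2_eq_square algebra_simps)
  also have "\<dots> = (\<integral>x. (?S x)\<^sup>2 \<partial>M) + 2 * y n * (\<integral>x. ?S x * ?e x \<partial>M) + (y n)\<^sup>2 * (\<integral>x. (?e x)\<^sup>2 \<partial>M)"
  proof -
    have "integrable M (\<lambda>x. (?S x)\<^sup>2)" "integrable M (\<lambda>x. (?e x)\<^sup>2)" "integrable M (\<lambda>x. ?S x * ?e x)"
      using S sq_int[of "t - int n"] integrable_product[OF S sq_int] by (auto simp: square_integrable_def)
    then show ?thesis by simp
  qed
  finally show ?case unfolding cross variance Suc.IH by simp
qed simp

text \<open>
  Orthogonality gives this for finite sums, and the mean-square limit preserves it.
\<close>

lemma isometry:
  assumes "shift_series M y eps t Y"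
  shows "(\<lambda>k. v * (y k)\<^sup>2) sums (\<integral>x. (Y x)\<^sup>2 \<partial>M)"
  using L2_tendsto_square_integral[OF assms[unfolded shift_series_def L2_sums_def]]
  by (simp add: finite_isometry sums_def)

lemma isometry_energy:
  assumes "shift_series M (fps_nth f) eps t Y" and "v = 0 \<or> sq_summable f"
  shows "(\<integral>x. (Y x)\<^sup>2 \<partial>M) = v * energy f"
proof (cases "v = 0")
  case True
  then show ?thesis using isometry[OF assms(1)] by (simp add: sums_iff)
next
  case False
  then show ?thesis using assms isometry[OF assms(1)]
    by (auto simp: sums_iff energy_def sq_summable_def suminf_mult)
qed

lemma coefficients_sq_summable:
  assumes "shift_series M (fps_nth f) eps t Y" "v \<noteq> 0"
  shows "sq_summable f"
  using isometry[OF assms(1)] assms(2) by (auto simp: sums_iff sq_summable_def summable_cmult_iff)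

lemma shift_series_of_energy_tendsto:
  assumes Y: "\<And>u. shift_series M (fps_nth f) eps u (Y u)"
    and V: "shift_series M (fps_nth b) eps t V"
    and lim: "v \<noteq> 0 \<Longrightarrow> energy_tendsto (\<lambda>n. truncated n c * f) b sequentially"
  shows "shift_series M (fps_nth c) Y t V"
  unfolding shift_series_def L2_sums_def L2_tendsto_def
proof (intro conjI)
  let ?S = "\<lambda>n x. \<Sum>k<n. fps_nth c k * Y (t - int k) x"
  have S: "shift_series M (fps_nth (truncated n c * f)) eps t (?S n)" for n
    by (rule shift_series_truncated_mult[OF Y])
  show "\<forall>\<^sub>F n in sequentially. square_integrable M (?S n)" "square_integrable M V"
    using shift_series_square_integrable[OF S] shift_series_square_integrable[OF V] by auto
  have SV: "shift_series M (fps_nth (truncated n c * f - b)) eps t (\<lambda>x. ?S n x - V x)" for n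
    by (rule shift_series_diff[OF S V])
  have eq: "\<forall>\<^sub>F n in sequentially. v * energy (truncated n c * f - b) = (\<integral>x. (?S n x - V x)\<^sup>2 \<partial>M)"
  proof (cases "v = 0")
    case True
    then show ?thesis using isometry_energy[OF SV] by simp
  next
    case False
    from lim[OF this, unfolded energy_tendsto_def, THEN conjunct1] show ?thesis
      by eventually_elim (simp add: isometry_energy[OF SV])
  qed
  have "(\<lambda>n. v * energy (truncated n c * f - b)) \<longlonglongrightarrow> 0"
    using lim by (cases "v = 0") (auto simp: energy_tendsto_def intro: tendsto_mult_right_zero)
  then show "(\<lambda>n. \<integral>x. (?S n x - V x)\<^sup>2 \<partial>M) \<longlonglongrightarrow> 0"
    by (rule Lim_transform_eventually[OF _ eq])
qed

text \<open>
  Compare \<open>W\<close> with the finite filters that converge to it.  The factor \<open>4\<close> is what two uses of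
  \<open>(x + y)\<^sup>2 \<le> 2 x\<^sup>2 + 2 y\<^sup>2\<close> cost.
\<close>

lemma filter_distance_bound:
  assumes Y: "\<And>u. shift_series M (fps_nth f) eps u (Y u)"
    and V: "shift_series M (fps_nth b) eps t V"
    and a: "abs_summable a" and W: "shift_series M (fps_nth a) Y t W"
    and b: "v \<noteq> 0 \<Longrightarrow> sq_summable (a * f - b)"
  shows "(\<integral>x. (W x - V x)\<^sup>2 \<partial>M) \<le> 4 * (v * energy (a * f - b))"
proof -
  let ?S = "\<lambda>n x. \<Sum>k<n. fps_nth a k * Y (t - int k) x"
  let ?d = "\<lambda>n. \<integral>x. (?S n x - W x)\<^sup>2 \<partial>M"
  let ?e = "\<lambda>n. v * energy (truncated n a * f - a * f)"
  have S: "shift_series M (fps_nth (truncated n a * f)) eps t (?S n)" for n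
    by (rule shift_series_truncated_mult[OF Y])
  have SV: "shift_series M (fps_nth (truncated n a * f - b)) eps t (\<lambda>x. ?S n x - V x)" for n
    by (rule shift_series_diff[OF S V])
  have f: "sq_summable f" if "v \<noteq> 0" using coefficients_sq_summable[OF Y that] .
  have e: "?e \<longlonglongrightarrow> 0"
    using truncated_mult_tendsto[OF a f] 
    by (cases "v = 0") (auto simp: energy_tendsto_def intro: tendsto_mult_right_zero)
  have d: "?d \<longlonglongrightarrow> 0" using W by (simp add: shift_series_def L2_sums_def L2_tendsto_def)
  have le: "(\<integral>x. (W x - V x)\<^sup>2 \<partial>M) \<le> 2 * ?d n + 2 * (2 * ?e n + 2 * (v * energy (a * f - b)))" for n
  proof -
    have si: "square_integrable M (\<lambda>x. W x - ?S n x)" "square_integrable M (\<lambda>x. ?S n x - V x)"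
      using shift_series_square_integrable[OF W] shift_series_square_integrable[OF S]
        shift_series_square_integrable[OF V] by (auto intro: square_integrable_diff)
    have dW: "(\<integral>x. (W x - ?S n x)\<^sup>2 \<partial>M) = ?d n" by (simp add: power2_commute)
    have dV: "(\<integral>x. (?S n x - V x)\<^sup>2 \<partial>M) \<le> 2 * ?e n + 2 * (v * energy (a * f - b))"
    proof (cases "v = 0")
      case True
      then show ?thesis using isometry_energy[OF SV] by simp
    next
      case False
      have "abs_summable (truncated n a - a)" 
        unfolding abs_summable_def
        by (intro summable_comparison_test'[OF a[unfolded abs_summable_def], of 0]) auto
      then have s1: "sq_summable (truncated n a * f - a * f)"
        unfolding left_diff_distrib[symmetric] by (rule sq_summable_mult[OF _ f[OF False]])
      have eq: "truncated n a * f - b = (truncated n a * f - a * f) + (a * f - b)" by simp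
      have "(\<integral>x. (?S n x - V x)\<^sup>2 \<partial>M) = v * energy (truncated n a * f - b)"
        using sq_summable_add[OF s1 b[OF False]] by (intro isometry_energy[OF SV]) simp
      also have "\<dots> \<le> v * (2 * energy (truncated n a * f - a * f) + 2 * energy (a * f - b))"
        unfolding eq using energy_add[OF s1 b[OF False]] v_nonneg by (intro mult_left_mono) simp_all
      finally show ?thesis by (simp add: distrib_left mult.left_commute)
    qed
    have "(\<integral>x. (W x - V x)\<^sup>2 \<partial>M) \<le> 
        2 * (\<integral>x. (W x - ?S n x)\<^sup>2 \<partial>M) + 2 * (\<integral>x. (?S n x - V x)\<^sup>2 \<partial>M)"
      using integral_square_add_le[OF si] by simp
    also have "\<dots> \<le> 2 * ?d n + 2 * (2 * ?e n + 2 * (v * energy (a * f - b)))"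
      unfolding dW by (intro add_mono mult_left_mono dV) auto
    finally show ?thesis .
  qed
  have "(\<lambda>n. 2 * ?d n + 2 * (2 * ?e n + 2 * (v * energy (a * f - b)))) 
      \<longlonglongrightarrow> 2 * 0 + 2 * (2 * 0 + 2 * (v * energy (a * f - b)))"
    by (intro tendsto_intros d e)
  from LIMSEQ_le_const[OF this, of "\<integral>x. (W x - V x)\<^sup>2 \<partial>M"] show ?thesis using le by auto
qed

lemma Abel_shift_series_of_energy_tendsto:
  assumes Y: "\<And>u. shift_series M (fps_nth f) eps u (Y u)"
    and V: "shift_series M (fps_nth b) eps t V"
    and c: "\<And>r. 0 < r \<Longrightarrow> r < 1 \<Longrightarrow> abs_summable (weighted (\<lambda>k. r ^ k) c)"
    and lim: "v \<noteq> 0 \<Longrightarrow> energy_tendsto (\<lambda>r. weighted (\<lambda>k. r ^ k) c * f) b (at_left 1)"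
  shows "Abel_shift_series M (fps_nth c) Y t V"
proof -
  let ?c = "\<lambda>r. weighted (\<lambda>k. r ^ k) c"
  have Ysq: "square_integrable M (Y u)" for u by (rule shift_series_square_integrable[OF Y])
  have YK: "(\<integral>x. (Y u x)\<^sup>2 \<partial>M) \<le> v * energy f" for u
    using isometry_energy[OF Y, of u] coefficients_sq_summable[OF Y] by fastforce
  have "\<exists>W. shift_series M (\<lambda>k. r ^ k * fps_nth c k) Y t W" if "0 < r" "r < 1" for r
    unfolding shift_series_def
    using Ysq YK c[OF that] by (intro L2_sums_absolutely_convergent) (auto simp: abs_summable_def)
  then obtain W where W: "\<And>r. 0 < r \<Longrightarrow> r < 1 \<Longrightarrow> shift_series M (\<lambda>k. r ^ k * fps_nth c k) Y t (W r)"
    by metis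
  have ev: "\<forall>\<^sub>F r in at_left 1. 0 < r \<and> r < (1::real)"
    by (auto simp: eventually_at_left_field intro: exI[of _ 0])
  have "L2_tendsto M W V (at_left 1)"
    unfolding L2_tendsto_def
  proof (intro conjI)
    show "\<forall>\<^sub>F r in at_left 1. square_integrable M (W r)"
      using ev by eventually_elim (use W shift_series_square_integrable in blast)
    show "square_integrable M V" by (rule shift_series_square_integrable[OF V])
    have lim0: "((\<lambda>r. 4 * (v * energy (?c r * f - b))) \<longlongrightarrow> 0) (at_left 1)"
      using lim by (cases "v = 0") (auto simp: energy_tendsto_def intro: tendsto_mult_right_zero)
    have "\<forall>\<^sub>F r in at_left 1. v \<noteq> 0 \<longrightarrow> sq_summable (?c r * f - b)"
      using lim by (cases "v = 0") (auto simp: energy_tendsto_def)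
    with ev have "\<forall>\<^sub>F r in at_left 1. (\<integral>x. (W r x - V x)\<^sup>2 \<partial>M) \<le> 4 * (v * energy (?c r * f - b))"
    proof eventually_elim
      case (elim r)
      have "fps_nth (?c r) = (\<lambda>k. r ^ k * fps_nth c k)" by (simp add: fun_eq_iff)
      then have "shift_series M (fps_nth (?c r)) Y t (W r)"
        using W[of r] elim by simp
      then show ?case using elim by (intro filter_distance_bound[OF Y V c]) auto
    qed
    then show "((\<lambda>r. \<integral>x. (W r x - V x)\<^sup>2 \<partial>M) \<longlongrightarrow> 0) (at_left 1)"
      by (intro tendsto_sandwich[OF _ _ tendsto_const lim0]) auto
  qed
  then show ?thesis using W unfolding Abel_shift_series_def by blast
qed

end

section \<open>The news process\<close>

text \<open>
  A common distribution makes \<open>E\<bar>Z\<^sub>t\<bar>\<close> independent of \<open>t\<close>, so the news are one fixed centred function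
  of the \<open>Z\<^sub>t\<close>; independence is preserved by applying it, and yields orthogonality.
\<close>

lemma (in prob_space) news_white_noise:
  assumes Z: "iid_standardized M Z"
  shows "white_noise M (\<lambda>t. news M \<theta> \<gamma> (Z (t - 1)))"
proof -
  have ind: "indep_vars (\<lambda>_. borel) Z UNIV" and dist: "\<And>t u. distr M borel (Z t) = distr M borel (Z u)"
    and Z2: "\<And>t. integrable M (\<lambda>x. (Z t x)\<^sup>2)" and Z0: "\<And>t. (\<integral>x. Z t x \<partial>M) = 0"
    using Z by (auto simp: iid_standardized_def)
  have [measurable]: "Z t \<in> borel_measurable M" for t
    using ind by (auto simp: indep_vars_def)
  define m where "m = (\<integral>x. \<bar>Z 0 x\<bar> \<partial>M)"
  define h where "h y = \<theta> * y + \<gamma> * (\<bar>y\<bar> - m)" for y :: real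
  have [measurable]: "h \<in> borel_measurable borel" unfolding h_def by measurable
  have same: "(\<integral>x. f (Z t x) \<partial>M) = (\<integral>x. f (Z u x) \<partial>M)"
    if [measurable]: "f \<in> borel_measurable borel" for f :: "real \<Rightarrow> real" and t u
  proof -
    have "(\<integral>y. f y \<partial>distr M borel (Z t)) = (\<integral>x. f (Z t x) \<partial>M)" for t
      by (rule integral_distr) measurable
    then show ?thesis using dist[of t u] by metis
  qed
  have news: "news M \<theta> \<gamma> (Z t) x = h (Z t x)" for t x
    using same[of abs t 0] by (simp add: news_def h_def m_def)
  have sqZ: "square_integrable M (Z t)" and sqA: "square_integrable M (\<lambda>x. \<bar>Z t x\<bar>)"
    and sqc: "square_integrable M (\<lambda>x. c)" for t c
    using Z2 by (auto simp: square_integrable_def)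
  have sq: "square_integrable M (\<lambda>x. h (Z t x))" for t
    unfolding h_def by (intro square_integrable_add square_integrable_cmult square_integrable_diff sqZ sqA sqc)
  have int: "integrable M X" if "square_integrable M X" for X
    using integrable_product[OF that sqc[of 1]] by simp
  have mean: "(\<integral>x. h (Z t x) \<partial>M) = 0" for t
  proof -
    have "(\<integral>x. h (Z t x) \<partial>M) = \<theta> * (\<integral>x. Z t x \<partial>M) + \<gamma> * ((\<integral>x. \<bar>Z t x\<bar> \<partial>M) - m)"
      unfolding h_def using int[OF sqZ[of t]] int[OF sqA[of t]] by (simp add: prob_space)
    also have "\<dots> = 0" using same[of abs t 0] by (simp add: Z0 m_def)
    finally show ?thesis .
  qed
  have orth: "(\<integral>x. h (Z t x) * h (Z u x) \<partial>M) = 0" if "t \<noteq> u" for t u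
  proof -
    have "indep_vars (\<lambda>_. borel) (\<lambda>i x. h (Z i x)) {t, u}"
      by (rule indep_vars_compose2[OF indep_vars_subset[OF ind]]) auto
    from indep_vars_lebesgue_integral[OF _ this] int[OF sq]
    have "(\<integral>x. (\<Prod>i\<in>{t, u}. h (Z i x)) \<partial>M) = (\<Prod>i\<in>{t, u}. \<integral>x. h (Z i x) \<partial>M)" by simp
    then show ?thesis using that by (simp add: mean)
  qed
  show ?thesis
    unfolding white_noise_def news
  proof (intro conjI allI impI exI)
    show "(\<integral>x. (h (Z (t - 1) x))\<^sup>2 \<partial>M) = (\<integral>x. (h (Z 0 x))\<^sup>2 \<partial>M)" for t
      by (rule same) measurable
  qed (simp_all add: sq mean orth)
qed

section \<open>The log-volatility process\<close>

theorem corollary1p1: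
  fixes M :: "'a measure"
    and Z \<sigma> :: "int \<Rightarrow> 'a \<Rightarrow> real"
    and \<theta> \<gamma> \<omega> d :: real
    and s p q :: nat
    and \<alpha> \<beta> :: "real poly"
    and lam :: "nat \<Rightarrow> real"
  assumes "prob_space M"
    and "iid_standardized M Z"
    and "s \<ge> 1"
    and "degree \<alpha> = p" and "coeff \<alpha> 0 = 1"
    and "degree \<beta> = q" and "coeff \<beta> 0 = 1"
    and no_common_root: "\<not> (\<exists>z. cpoly \<alpha> z = 0 \<and> cpoly \<beta> z = 0)"
    and roots_outside: "\<forall>z. norm z \<le> 1 \<longrightarrow> cpoly \<beta> z \<noteq> 0"
    and "d < 1 / 2"
    and lam: "disc_expansion (\<lambda>z. cpoly \<alpha> z / cpoly \<beta> z * frac_diff s (- d) z) lam"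
    and "\<forall>t. \<sigma> t \<in> borel_measurable M"
    and "\<forall>t. AE x in M. \<sigma> t x > 0"
    and ln_sigma: "\<forall>t. shift_series M lam (\<lambda>u. news M \<theta> \<gamma> (Z u)) (t - 1)
                        (\<lambda>x. ln ((\<sigma> t x)\<^sup>2) - \<omega>)"
  shows "causal_SARFIMA M q p d s (\<lambda>t x. ln ((\<sigma> t x)\<^sup>2))"
proof -
  interpret prob_space M by fact
  note s = \<open>s \<ge> 1\<close>
  define eps where "eps t = news M \<theta> \<gamma> (Z (t - 1))" for t :: int
  have wn: "white_noise M eps" unfolding eps_def by (rule news_white_noise) fact
  then obtain v where v: "\<forall>t. (\<integral>x. (eps t x)\<^sup>2 \<partial>M) = v" by (auto simp: white_noise_def)
  interpret white_noise_filter M eps v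
    using wn v by unfold_locales (auto simp: white_noise_def)

  define L where "L = Abs_fps lam"
  define \<rho> where "\<rho> = fps_of_poly \<alpha> * inverse (fps_of_poly \<beta>)"
  define c where "c = fps_of_poly \<beta> * seasonal_binomial s d"
  define Y where "Y t x = ln ((\<sigma> t x)\<^sup>2) - \<omega>" for t x
  define V where "V t x = (\<Sum>j\<le>degree \<alpha>. coeff \<alpha> j * eps (t - int j) x)" for t x

  have poly_l1: "abs_summable (fps_of_poly r)" for r :: "real poly"
    by (rule abs_summable_finite_support[of "Suc (degree r)"]) (simp add: coeff_eq_0)
  have inv: "fps_of_poly \<beta> * inverse (fps_of_poly \<beta>) = 1"
    using \<open>coeff \<beta> 0 = 1\<close> by (intro inverse_mult_eq_1') auto
  have \<rho>: "abs_summable \<rho>" "fps_of_poly \<beta> * \<rho> = fps_of_poly \<alpha>"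
    using inverse_poly_abs_summable[OF \<open>coeff \<beta> 0 = 1\<close>] roots_outside inv
    by (auto simp: \<rho>_def mult.left_commute intro: abs_summable_mult poly_l1)

  have nth_L: "fps_nth L = lam" by (simp add: L_def fun_eq_iff)
  \<comment> \<open>The coefficients of \<open>\<lambda>\<close> are only given through the values of the sum in the disc;
    uniqueness of power series turns this into an identity of formal series.\<close>
  have "fps_nth (fps_of_poly \<beta> * L) = fps_nth (fps_of_poly \<alpha> * seasonal_binomial s (- d))"
  proof (rule disc_expansion_unique)
    show "disc_expansion (\<lambda>z. cpoly \<alpha> z * frac_diff s (- d) z) 
        (fps_nth (fps_of_poly \<alpha> * seasonal_binomial s (- d)))"
      by (intro disc_expansion_mult disc_expansion_poly disc_expansion_frac_diff s)
    have "disc_expansion (\<lambda>z. cpoly \<beta> z * (cpoly \<alpha> z / cpoly \<beta> z * frac_diff s (- d) z))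
        (fps_nth (fps_of_poly \<beta> * L))"
      by (intro disc_expansion_mult disc_expansion_poly) (use lam in \<open>simp only: nth_L\<close>)
    then show "disc_expansion (\<lambda>z. cpoly \<alpha> z * frac_diff s (- d) z) (fps_nth (fps_of_poly \<beta> * L))"
      using roots_outside by (subst (asm) disc_expansion_cong) auto
  qed
  then have "fps_of_poly \<beta> * L = fps_of_poly \<alpha> * seasonal_binomial s (- d)"
    by (simp add: fps_eq_iff)
  then have "inverse (fps_of_poly \<beta>) * (fps_of_poly \<beta> * L) = \<rho> * seasonal_binomial s (- d)"
    by (simp add: \<rho>_def mult_ac)
  then have L: "L = \<rho> * seasonal_binomial s (- d)"
    using inv by (simp add: mult.assoc[symmetric] mult.commute[of "inverse _"])
  have cL: "c * L = fps_of_poly \<alpha>"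
  proof -
    have "c * L = (fps_of_poly \<beta> * \<rho>) * (seasonal_binomial s (- d) * seasonal_binomial s d)"
      unfolding c_def L by (simp add: mult_ac)
    then show ?thesis by (simp add: \<rho>(2) seasonal_binomial_inverse[OF s])
  qed
  have c: "disc_expansion (\<lambda>z. cpoly \<beta> z * frac_diff s d z) (fps_nth c)"
    unfolding c_def by (intro disc_expansion_mult disc_expansion_poly disc_expansion_frac_diff s)

  have lamY: "shift_series M lam eps t (Y t)" for t
    using ln_sigma[rule_format, of t]
    by (simp add: shift_series_def eps_def Y_def[abs_def] algebra_simps)
  then have LY: "shift_series M (fps_nth L) eps t (Y t)" for t by (simp only: nth_L)
  have V: "shift_series M (fps_nth (fps_of_poly \<alpha>)) eps t (V t)" for t
    using shift_series_finite[where X = eps and n = "degree \<alpha>" and f = "fps_of_poly \<alpha>" and M = M and t = t]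
    by (simp add: V_def[abs_def] coeff_eq_0 sq_int)

  have "(if d > -1 then shift_series else Abel_shift_series) M (fps_nth c) Y t (V t)" for t
  proof -
    consider "0 \<le> d" | "-1 < d" "d < 0" | "d \<le> -1" by linarith
    then show ?thesis
    proof cases
      case 1
      have "abs_summable c"
        unfolding c_def using 1 \<open>d < 1 / 2\<close> 
        by (intro abs_summable_mult poly_l1 seasonal_binomial_l1 s) auto
      \<comment> \<open>Square summability of \<open>\<lambda>\<close> comes from the assumed mean-square convergence, by isometry.\<close>
      then have "energy_tendsto (\<lambda>n. truncated n c * L) (fps_of_poly \<alpha>) sequentially" if "v \<noteq> 0"
        using truncated_mult_tendsto[of c L] coefficients_sq_summable[OF LY that] by (simp add: cL)
      then show ?thesis using 1 shift_series_of_energy_tendsto[OF LY V] by simp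
    next
      case 2
      interpret antipersistent_pair "seasonal_binomial s d" "seasonal_binomial s (- d)"
        using antipersistent_seasonal_binomial[OF s, of "- d"] 2 by simp
      have "energy_tendsto (\<lambda>n. truncated n c * L) (fps_of_poly \<alpha>) sequentially"
        unfolding c_def L truncated_def
        by (rule weighted_poly_product_tendsto[OF \<rho> truncation_tendsto])
      then show ?thesis using 2 shift_series_of_energy_tendsto[OF LY V] by simp
    next
      case 3
      have "energy_tendsto (\<lambda>r. weighted (\<lambda>k. r ^ k) c * L) (fps_of_poly \<alpha>) (at_left 1)"
        unfolding c_def L using seasonal_Abel_tendsto[OF s, of "- d"] 3
        by (intro weighted_poly_product_tendsto[OF \<rho>]) simp
      then have "Abel_shift_series M (fps_nth c) Y t (V t)"
        by (intro Abel_shift_series_of_energy_tendsto[OF LY V] disc_expansion_Abel_summable[OF c])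
      then show ?thesis using 3 by simp
    qed
  qed
  then have "SARFIMA_equation M \<beta> \<alpha> d s \<omega> eps (\<lambda>t x. ln ((\<sigma> t x)\<^sup>2))"
    unfolding SARFIMA_equation_def using c by (auto simp: Y_def[abs_def] V_def[abs_def])
  moreover have "(\<lambda>x. ln ((\<sigma> t x)\<^sup>2)) \<in> borel_measurable M" for t
  proof -
    have [measurable]: "\<sigma> t \<in> borel_measurable M" using assms by blast
    show ?thesis by measurable
  qed
  ultimately have "SARFIMA_with M q p d s \<omega> \<beta> \<alpha> eps (\<lambda>t x. ln ((\<sigma> t x)\<^sup>2))"
    unfolding SARFIMA_with_def using assms wn by auto
  moreover have "\<forall>t. shift_series M lam eps t (\<lambda>x. ln ((\<sigma> t x)\<^sup>2) - \<omega>)"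
    using lamY by (simp add: Y_def[abs_def])
  ultimately show ?thesis
    unfolding causal_SARFIMA_def using lam by blast
qed

end
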